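(* Let $M^n\subset\mathbb{R}^{n+k}$ be a complete, properly immersed translating soliton with mean curvature vector $\vec H$, and suppose that the unit normal field $\xi=-\vec H/|\vec H|$ satisfies $\nabla^\perp\xi=0$ at every point where $\xi$ is well defined (i.e. where $\vec H\neq 0$); in particular this holds when $M$ is a hypersurface ($k=1$). Then $$\inf_M |\vec H|^2=0,$$ which is equivalent to $$\sup_M|\nabla S|^2=1,$$ where $S(X)=\langle X,W\rangle$ and $\nabla S$ is the gradient on $M$ of the restriction of $S$ to $M$.
   Context: Let $W\in\mathbb{R}^{n+k}$ be a fixed unit vector. For an immersed $n$-dimensional submanifold $M\subset\mathbb{R}^{n+k}$ with induced metric, a local orthonormal tangent frame $\{e_i\}$ and a local orthonormal normal frame $\{\nu_\alpha\}_{1\le\alpha\le k}$, put $h_{\alpha ij}=\langle D_{e_i}\nu_\alpha,e_j\rangle$ (with $D$ the directional derivative of $\mathbb{R}^{n+k}$) and $H_\alpha=\sum_j h_{\alpha jj}$; the mean curvature vector is $\vec H=-\sum_\alpha H_\alpha\nu_\alpha$. $M$ is a translating soliton (with respect to $W$) if $H_\alpha=\langle\nu_\alpha,W\rangle$ on $M$ for all $1\le\alpha\le k$. $X$ denotes the position vector, and $\nabla^\perp$ is the normal connection of $M$. *)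

theory Defs
  imports "HOL-Analysis.Analysis"
begin

unbundle inner_syntax

section \<open>Smooth maps between Euclidean spaces\<close>

text \<open>
  Both predicates are meant for open \<open>S\<close>.  On a finite-dimensional domain, existence of the
  derivative together with continuity of all its directional components is continuous
  differentiability in the usual sense.
\<close>

primrec Ck_on :: "nat \<Rightarrow> 'a::euclidean_space set \<Rightarrow> ('a \<Rightarrow> 'b::real_normed_vector) \<Rightarrow> bool" where
  "Ck_on 0 S f \<longleftrightarrow> continuous_on S f"
| "Ck_on (Suc r) S f \<longleftrightarrow>
     (\<forall>x\<in>S. f differentiable (at x)) \<and>
     (\<forall>v. Ck_on r S (\<lambda>x. frechet_derivative f (at x) v))"

definition smooth_on :: "'a::euclidean_space set \<Rightarrow> ('a \<Rightarrow> 'b::real_normed_vector) \<Rightarrow> bool" where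
  "smooth_on S f \<longleftrightarrow> (\<forall>r. Ck_on r S f)"


section \<open>Smooth manifolds\<close>

text \<open>
  A chart is a pair of a domain and a coordinate map.  The dimension of the manifold is
  \<open>CARD('n)\<close>.  The atlas need not be maximal.
\<close>

type_synonym ('m, 'n) chart = "'m set \<times> ('m \<Rightarrow> real ^ 'n)"

definition chart_on :: "'m topology \<Rightarrow> ('m, 'n::finite) chart \<Rightarrow> bool" where
  "chart_on T = (\<lambda>(U, \<phi>).
     openin T U \<and> open (\<phi> ` U) \<and>
     homeomorphic_map (subtopology T U) (subtopology euclidean (\<phi> ` U)) \<phi>)"

text \<open>
  The local representative \<open>f \<circ> \<phi>\<^sup>-\<^sup>1\<close> of a map.  It carries information only on \<open>\<phi> ` U\<close>.
\<close>

definition in_chart :: "('m, 'n::finite) chart \<Rightarrow> ('m \<Rightarrow> 'b) \<Rightarrow> real ^ 'n \<Rightarrow> 'b" where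
  "in_chart = (\<lambda>(U, \<phi>) f. f \<circ> inv_into U \<phi>)"

definition smooth_manifold :: "'m topology \<Rightarrow> ('m, 'n::finite) chart set \<Rightarrow> bool" where
  "smooth_manifold T \<A> \<longleftrightarrow>
     Hausdorff_space T \<and> second_countable T \<and>
     (\<forall>c\<in>\<A>. chart_on T c) \<and>
     (\<Union>c\<in>\<A>. fst c) = topspace T \<and>
     (\<forall>c\<in>\<A>. \<forall>d\<in>\<A>. smooth_on (snd c ` (fst c \<inter> fst d)) (in_chart c (snd d)))"

definition manifold_smooth_on ::
  "('m, 'n::finite) chart set \<Rightarrow> 'm set \<Rightarrow> ('m \<Rightarrow> 'b::real_normed_vector) \<Rightarrow> bool" where
  "manifold_smooth_on \<A> V f \<longleftrightarrow> (\<forall>c\<in>\<A>. smooth_on (snd c ` (fst c \<inter> V)) (in_chart c f))"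

text \<open>
  The differential at \<open>p\<close> in a chart around \<open>p\<close> fixed once and for all.  The coordinate vector
  depends on that choice; the notions below, built from it, do not.
\<close>

definition chart_at :: "('m, 'n::finite) chart set \<Rightarrow> 'm \<Rightarrow> ('m, 'n) chart" where
  "chart_at \<A> p = (SOME c. c \<in> \<A> \<and> p \<in> fst c)"

definition differential ::
  "('m, 'n::finite) chart set \<Rightarrow> ('m \<Rightarrow> 'b::real_normed_vector) \<Rightarrow> 'm \<Rightarrow> real ^ 'n \<Rightarrow> 'b" where
  "differential \<A> f p =
     frechet_derivative (in_chart (chart_at \<A> p) f) (at (snd (chart_at \<A> p) p))"


section \<open>Immersed submanifolds\<close>

text \<open>
  The ambient space has dimension \<open>CARD('n) + CARD('k)\<close>.  The immersion need not be injective,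
  so all geometric objects are functions on the abstract manifold.
\<close>

definition immersion ::
  "'m topology \<Rightarrow> ('m, 'n::finite) chart set \<Rightarrow> ('m \<Rightarrow> real ^ ('n + 'k::finite)) \<Rightarrow> bool" where
  "immersion T \<A> F \<longleftrightarrow>
     manifold_smooth_on \<A> (topspace T) F \<and> (\<forall>p\<in>topspace T. inj (differential \<A> F p))"

text \<open>Tangent vectors are identified with their images under the differential of the immersion.
  With this identification the induced metric is the ambient inner product.\<close>

definition tangent_space ::
  "('m, 'n::finite) chart set \<Rightarrow> ('m \<Rightarrow> real ^ ('n + 'k::finite)) \<Rightarrow> 'm \<Rightarrow> (real ^ ('n + 'k)) set" where
  "tangent_space \<A> F p = range (differential \<A> F p)"

definition normal_space ::
  "('m, 'n::finite) chart set \<Rightarrow> ('m \<Rightarrow> real ^ ('n + 'k::finite)) \<Rightarrow> 'm \<Rightarrow> (real ^ ('n + 'k)) set" where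
  "normal_space \<A> F p = (tangent_space \<A> F p)\<^sup>\<bottom>"

text \<open>\<open>D\<^sub>X f\<close> at \<open>p\<close>, for \<open>X\<close> in the tangent space at \<open>p\<close>.\<close>

definition dir_deriv ::
  "('m, 'n::finite) chart set \<Rightarrow> ('m \<Rightarrow> real ^ ('n + 'k::finite)) \<Rightarrow>
   real ^ ('n + 'k) \<Rightarrow> ('m \<Rightarrow> 'b::real_normed_vector) \<Rightarrow> 'm \<Rightarrow> 'b" where
  "dir_deriv \<A> F X f p = differential \<A> f p (inv (differential \<A> F p) X)"

definition gradient ::
  "('m, 'n::finite) chart set \<Rightarrow> ('m \<Rightarrow> real ^ ('n + 'k::finite)) \<Rightarrow>
   ('m \<Rightarrow> real) \<Rightarrow> 'm \<Rightarrow> real ^ ('n + 'k)" where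
  "gradient \<A> F f p =
     (THE v. v \<in> tangent_space \<A> F p \<and>
             (\<forall>X\<in>tangent_space \<A> F p. v \<bullet> X = dir_deriv \<A> F X f p))"


section \<open>Completeness of the induced metric\<close>

text \<open>
  The library's notion of piecewise continuous differentiability puts no bound on the derivative
  near the finitely many exceptional points, so a curve may have infinite length.  The length is
  therefore a Lebesgue integral with values in \<open>[0, \<infinity>]\<close>.
\<close>

definition piecewise_C1_path ::
  "'m topology \<Rightarrow> ('m, 'n::finite) chart set \<Rightarrow> (real \<Rightarrow> 'm) \<Rightarrow> bool" where
  "piecewise_C1_path T \<A> \<gamma> \<longleftrightarrow>
     pathin T \<gamma> \<and>
     (\<forall>c\<in>\<A>. \<forall>a b. {a..b} \<subseteq> {0..1} \<and> \<gamma> ` {a..b} \<subseteq> fst c \<longrightarrow>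
        (snd c \<circ> \<gamma>) piecewise_C1_differentiable_on {a..b})"

definition path_length :: "('m \<Rightarrow> real ^ ('n::finite + 'k::finite)) \<Rightarrow> (real \<Rightarrow> 'm) \<Rightarrow> ennreal" where
  "path_length F \<gamma> = (\<integral>\<^sup>+ t\<in>{0..1}. ennreal (norm (vector_derivative (F \<circ> \<gamma>) (at t))) \<partial>lborel)"

text \<open>The distance is \<open>\<infinity>\<close> between different components; connectedness is not assumed.\<close>

definition induced_dist ::
  "'m topology \<Rightarrow> ('m, 'n::finite) chart set \<Rightarrow> ('m \<Rightarrow> real ^ ('n + 'k::finite)) \<Rightarrow>
   'm \<Rightarrow> 'm \<Rightarrow> ennreal" where
  "induced_dist T \<A> F p q =
     (INF \<gamma>\<in>{\<gamma>. piecewise_C1_path T \<A> \<gamma> \<and> \<gamma> 0 = p \<and> \<gamma> 1 = q}. path_length F \<gamma>)"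

definition complete_immersed ::
  "'m topology \<Rightarrow> ('m, 'n::finite) chart set \<Rightarrow> ('m \<Rightarrow> real ^ ('n + 'k::finite)) \<Rightarrow> bool" where
  "complete_immersed T \<A> F \<longleftrightarrow>
     (\<forall>x. range x \<subseteq> topspace T \<and>
          (\<forall>\<epsilon>>0. \<exists>N::nat. \<forall>i\<ge>N. \<forall>j\<ge>N. induced_dist T \<A> F (x i) (x j) < ennreal \<epsilon>) \<longrightarrow>
          (\<exists>p\<in>topspace T. (\<lambda>i. induced_dist T \<A> F (x i) p) \<longlonglongrightarrow> 0))"


section \<open>Extrinsic geometry\<close>

definition orthonormal_family :: "('i \<Rightarrow> 'a::real_inner) \<Rightarrow> bool" where
  "orthonormal_family v \<longleftrightarrow> (\<forall>i j. v i \<bullet> v j = (if i = j then 1 else 0))"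

definition tangent_frame_on ::
  "'m topology \<Rightarrow> ('m, 'n::finite) chart set \<Rightarrow> ('m \<Rightarrow> real ^ ('n + 'k::finite)) \<Rightarrow>
   'm set \<Rightarrow> ('n \<Rightarrow> 'm \<Rightarrow> real ^ ('n + 'k)) \<Rightarrow> bool" where
  "tangent_frame_on T \<A> F V e \<longleftrightarrow>
     openin T V \<and> (\<forall>i. manifold_smooth_on \<A> V (e i)) \<and>
     (\<forall>p\<in>V. (\<forall>i. e i p \<in> tangent_space \<A> F p) \<and> orthonormal_family (\<lambda>i. e i p))"

definition normal_frame_on ::
  "'m topology \<Rightarrow> ('m, 'n::finite) chart set \<Rightarrow> ('m \<Rightarrow> real ^ ('n + 'k::finite)) \<Rightarrow>
   'm set \<Rightarrow> ('k \<Rightarrow> 'm \<Rightarrow> real ^ ('n + 'k)) \<Rightarrow> bool" where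
  "normal_frame_on T \<A> F V \<nu> \<longleftrightarrow>
     openin T V \<and> (\<forall>\<alpha>. manifold_smooth_on \<A> V (\<nu> \<alpha>)) \<and>
     (\<forall>p\<in>V. (\<forall>\<alpha>. \<nu> \<alpha> p \<in> normal_space \<A> F p) \<and> orthonormal_family (\<lambda>\<alpha>. \<nu> \<alpha> p))"

definition second_fund_coeff ::
  "('m, 'n::finite) chart set \<Rightarrow> ('m \<Rightarrow> real ^ ('n + 'k::finite)) \<Rightarrow>
   ('n \<Rightarrow> 'm \<Rightarrow> real ^ ('n + 'k)) \<Rightarrow> ('k \<Rightarrow> 'm \<Rightarrow> real ^ ('n + 'k)) \<Rightarrow>
   'k \<Rightarrow> 'n \<Rightarrow> 'n \<Rightarrow> 'm \<Rightarrow> real" where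
  "second_fund_coeff \<A> F e \<nu> \<alpha> i j p = dir_deriv \<A> F (e i p) (\<nu> \<alpha>) p \<bullet> e j p"

definition mean_curv_coeff ::
  "('m, 'n::finite) chart set \<Rightarrow> ('m \<Rightarrow> real ^ ('n + 'k::finite)) \<Rightarrow>
   ('n \<Rightarrow> 'm \<Rightarrow> real ^ ('n + 'k)) \<Rightarrow> ('k \<Rightarrow> 'm \<Rightarrow> real ^ ('n + 'k)) \<Rightarrow>
   'k \<Rightarrow> 'm \<Rightarrow> real" where
  "mean_curv_coeff \<A> F e \<nu> \<alpha> p = (\<Sum>j\<in>UNIV. second_fund_coeff \<A> F e \<nu> \<alpha> j j p)"

text \<open>The vector does not depend on the frames, which exist around every point.\<close>

definition mean_curv_vec ::
  "'m topology \<Rightarrow> ('m, 'n::finite) chart set \<Rightarrow> ('m \<Rightarrow> real ^ ('n + 'k::finite)) \<Rightarrow>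
   'm \<Rightarrow> real ^ ('n + 'k)" where
  "mean_curv_vec T \<A> F p =
     (THE h. \<exists>V e \<nu>. p \<in> V \<and> tangent_frame_on T \<A> F V e \<and> normal_frame_on T \<A> F V \<nu> \<and>
        h = - (\<Sum>\<alpha>\<in>UNIV. mean_curv_coeff \<A> F e \<nu> \<alpha> p *\<^sub>R \<nu> \<alpha> p))"

definition translating_soliton ::
  "'m topology \<Rightarrow> ('m, 'n::finite) chart set \<Rightarrow> ('m \<Rightarrow> real ^ ('n + 'k::finite)) \<Rightarrow>
   real ^ ('n + 'k) \<Rightarrow> bool" where
  "translating_soliton T \<A> F W \<longleftrightarrow>
     (\<forall>V e \<nu>. tangent_frame_on T \<A> F V e \<and> normal_frame_on T \<A> F V \<nu> \<longrightarrow>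
        (\<forall>p\<in>V. \<forall>\<alpha>. mean_curv_coeff \<A> F e \<nu> \<alpha> p = \<nu> \<alpha> p \<bullet> W))"

definition normal_part ::
  "('m, 'n::finite) chart set \<Rightarrow> ('m \<Rightarrow> real ^ ('n + 'k::finite)) \<Rightarrow> 'm \<Rightarrow>
   real ^ ('n + 'k) \<Rightarrow> real ^ ('n + 'k)" where
  "normal_part \<A> F p v = (THE w. w \<in> normal_space \<A> F p \<and> v - w \<in> tangent_space \<A> F p)"

definition normal_connection ::
  "('m, 'n::finite) chart set \<Rightarrow> ('m \<Rightarrow> real ^ ('n + 'k::finite)) \<Rightarrow>
   real ^ ('n + 'k) \<Rightarrow> ('m \<Rightarrow> real ^ ('n + 'k)) \<Rightarrow> 'm \<Rightarrow> real ^ ('n + 'k)" where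
  "normal_connection \<A> F X \<eta> p = normal_part \<A> F p (dir_deriv \<A> F X \<eta> p)"

text \<open>The field \<open>\<xi>\<close>; its value \<open>0\<close> where the mean curvature vector vanishes is never used.\<close>

definition principal_normal ::
  "'m topology \<Rightarrow> ('m, 'n::finite) chart set \<Rightarrow> ('m \<Rightarrow> real ^ ('n + 'k::finite)) \<Rightarrow>
   'm \<Rightarrow> real ^ ('n + 'k)" where
  "principal_normal T \<A> F p = - (mean_curv_vec T \<A> F p /\<^sub>R norm (mean_curv_vec T \<A> F p))"

definition parallel_principal_normal ::
  "'m topology \<Rightarrow> ('m, 'n::finite) chart set \<Rightarrow> ('m \<Rightarrow> real ^ ('n + 'k::finite)) \<Rightarrow> bool" where
  "parallel_principal_normal T \<A> F \<longleftrightarrow>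
     (\<forall>p\<in>topspace T. mean_curv_vec T \<A> F p \<noteq> 0 \<longrightarrow>
        (\<forall>X\<in>tangent_space \<A> F p. normal_connection \<A> F X (principal_normal T \<A> F) p = 0))"

end

theory Submission
  imports Defs
begin

text \<open>
  A soliton satisfies \<open>H = - W\<^sup>\<bottom>\<close>, which gives the equivalence through
  \<open>|\<nabla>S|\<^sup>2 = 1 - |W\<^sup>\<bottom>|\<^sup>2\<close>.  For the drift Laplacian
  \<open>L f = \<Delta> f - \<nabla> f \<bullet> W\<close> one has \<open>L F = - W\<close>, and if \<open>\<xi>\<close> is parallel,
  \<open>u = |H| = \<xi> \<bullet> W\<close> satisfies \<open>L u = - u * |A\<^sub>\<xi>|\<^sup>2 \<le> - u ^ 3 / n\<close>.  If \<open>u\<close> were bounded below by a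
  positive constant, properness would give a minimum \<open>p\<close> of \<open>u + \<epsilon> * |F|\<^sup>2\<close> for every \<open>\<epsilon> > 0\<close>.
  There \<open>L |F|\<^sup>2 = 2 * n - 2 * (F \<bullet> W)\<close> yields
  \<open>u(p) ^ 3 / n \<le> 2 * \<epsilon> * (n + |F(p)|)\<close>, while \<open>\<epsilon> * |F(p)|\<^sup>2\<close> stays bounded, so that the
  right-hand side is \<open>O(sqrt \<epsilon>)\<close>: a contradiction.
\<close>

section \<open>Calculus of continuously differentiable maps\<close>

text \<open>On a non-compact manifold the infimum of u need not be attained. The penalty \<epsilon>
  * |F|^2 repairs this because properness makes |F|^2 an exhaustion, while L |F|^2 grows only
  linearly in |F|: from \<epsilon> * |F(p)|^2 \<le> C follows \<epsilon> * |F(p)| \<le> sqrt (C *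
  \<epsilon>). The cube comes from Cauchy-Schwarz for the trace of A_\<xi>, which equals u. The
  positive lower bound on u also keeps \<xi> defined and smooth on all of M.

  All computations are done in a chart, without covariant derivatives. With G the local immersion
  and DG(v_j) an orthonormal frame, the soliton equation reads sum_j D^2 G(v_j, v_j) = DG(b) - W,
  where b collects the tangential part of the second derivatives together with that of W. Hence f
  \<mapsto> sum_j D^2 f(v_j, v_j) - Df(b) is the drift Laplacian, Christoffel symbols included in b,
  and Df(b) vanishes at a critical point. The price is that the fields v_j move; their derivatives
  disappear because they enter as an antisymmetric matrix contracted with the symmetric second
  fundamental form.\<close>

lemma Ck_on_cong:
  assumes "open S" "Ck_on r S f" "\<And>x. x \<in> S \<Longrightarrow> f x = g x"
  shows "Ck_on r S g"
  using assms
proof (induction r arbitrary: f g)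
  case 0
  then show ?case using continuous_on_cong by (metis Ck_on.simps(1))
next
  case (Suc r)
  have D: "f differentiable (at x)" if "x \<in> S" for x using Suc.prems(2) that by simp
  have G: "(g has_derivative frechet_derivative f (at x)) (at x)" if "x \<in> S" for x
    by (rule has_derivative_transform_within_open[OF D[OF that, unfolded frechet_derivative_works]
          Suc.prems(1) that Suc.prems(3)])
  have "Ck_on r S (\<lambda>x. frechet_derivative g (at x) v)" for v
  proof (rule Suc.IH[OF \<open>open S\<close>])
    show "Ck_on r S (\<lambda>x. frechet_derivative f (at x) v)" using Suc.prems(2) by simp
    show "frechet_derivative f (at x) v = frechet_derivative g (at x) v" if "x \<in> S" for x
      using frechet_derivative_at[OF G[OF that]] by simp
  qed
  then show ?case using G by (auto simp: differentiable_def)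
qed

lemma Ck_on_subset: "Ck_on r S f \<Longrightarrow> S' \<subseteq> S \<Longrightarrow> Ck_on r S' f"
  by (induction r arbitrary: f) (auto intro: continuous_on_subset)

lemma Ck_on_Suc_D: "Ck_on (Suc r) S f \<Longrightarrow> Ck_on r S f"
proof (induction r arbitrary: f)
  case 0
  then show ?case
    by (auto intro!: continuous_at_imp_continuous_on differentiable_imp_continuous_within)
next
  case (Suc r)
  then show ?case by (metis Ck_on.simps(2))
qed

text \<open>\<open>frechet_derivative\<close> is defined by choice. This rule lets each closure
  property name its derivative explicitly; uniqueness of derivatives and openness of
  \<open>S\<close> do the rest.\<close>

lemma Ck_on_SucI:
  assumes "open S" "\<And>x. x \<in> S \<Longrightarrow> (f has_derivative f' x) (at x)"
    "\<And>v. Ck_on r S (\<lambda>x. f' x v)"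
  shows "Ck_on (Suc r) S f"
proof -
  have "frechet_derivative f (at x) = f' x" if "x \<in> S" for x
    using frechet_derivative_at[OF assms(2)[OF that]] by simp
  then have "Ck_on r S (\<lambda>x. frechet_derivative f (at x) v)" for v
    by (intro Ck_on_cong[OF assms(1) assms(3)[of v]]) simp
  then show ?thesis using assms(2) by (auto simp: differentiable_def)
qed

lemma Ck_on_has_derivative:
  "Ck_on (Suc r) S f \<Longrightarrow> x \<in> S \<Longrightarrow> (f has_derivative frechet_derivative f (at x)) (at x)"
  by (simp add: frechet_derivative_works[symmetric])

lemma Ck_on_const [simp]: "Ck_on r S (\<lambda>x. c)"
  by (induction r arbitrary: c) auto

lemma Ck_on_bounded_linear:
  assumes "open S" "bounded_linear h" "Ck_on r S f"
  shows "Ck_on r S (\<lambda>x. h (f x))"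
  using assms(3)
proof (induction r arbitrary: f)
  case 0
  then show ?case
    using bounded_linear.continuous_on[OF assms(2)] by auto
next
  case (Suc r)
  show ?case
  proof (rule Ck_on_SucI[OF assms(1)])
    show "((\<lambda>x. h (f x)) has_derivative (\<lambda>v. h (frechet_derivative f (at x) v))) (at x)"
      if "x \<in> S" for x
      using bounded_linear.has_derivative[OF assms(2) Ck_on_has_derivative[OF Suc.prems that]] .
    show "Ck_on r S (\<lambda>x. h (frechet_derivative f (at x) v))" for v
      by (rule Suc.IH) (use Suc.prems in simp)
  qed
qed

lemma Ck_on_add:
  assumes "open S" "Ck_on r S f" "Ck_on r S g"
  shows "Ck_on r S (\<lambda>x. f x + g x)"
  using assms(2,3)
proof (induction r arbitrary: f g)
  case 0
  then show ?case by (auto intro: continuous_on_add)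
next
  case (Suc r)
  show ?case
  proof (rule Ck_on_SucI[OF assms(1)])
    show "((\<lambda>x. f x + g x) has_derivative
        (\<lambda>v. frechet_derivative f (at x) v + frechet_derivative g (at x) v)) (at x)"
      if "x \<in> S" for x
      using Suc.prems that by (intro has_derivative_add Ck_on_has_derivative)
    show "Ck_on r S (\<lambda>x. frechet_derivative f (at x) v + frechet_derivative g (at x) v)" for v
      by (rule Suc.IH) (use Suc.prems in simp_all)
  qed
qed

lemma Ck_on_sum:
  assumes "open S" "\<And>i. i \<in> I \<Longrightarrow> Ck_on r S (f i)"
  shows "Ck_on r S (\<lambda>x. \<Sum>i\<in>I. f i x)"
  using assms(2)
  by (induction I rule: infinite_finite_induct) (auto intro: Ck_on_add[OF assms(1)])

text \<open>The derivative of a product still contains the undifferentiated factors;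
  \<open>Ck_on_Suc_D\<close> lowers their order so that the induction hypothesis applies. Scalar
  multiplication and the inner product are the instances needed.\<close>

lemma Ck_on_bilinear:
  assumes "open S" "bounded_bilinear h" "Ck_on r S f" "Ck_on r S g"
  shows "Ck_on r S (\<lambda>x. h (f x) (g x))"
  using assms(3,4)
proof (induction r arbitrary: f g)
  case 0
  then show ?case by (auto intro: bounded_bilinear.continuous_on[OF assms(2)])
next
  case (Suc r)
  show ?case
  proof (rule Ck_on_SucI[OF assms(1)])
    show "((\<lambda>x. h (f x) (g x)) has_derivative
        (\<lambda>v. h (f x) (frechet_derivative g (at x) v) + h (frechet_derivative f (at x) v) (g x))) (at x)"
      if "x \<in> S" for x
      using Suc.prems that by (intro bounded_bilinear.FDERIV[OF assms(2)] Ck_on_has_derivative)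
    show "Ck_on r S (\<lambda>x. h (f x) (frechet_derivative g (at x) v) +
        h (frechet_derivative f (at x) v) (g x))" for v
      using Suc.prems Ck_on_Suc_D[OF Suc.prems(1)] Ck_on_Suc_D[OF Suc.prems(2)]
      by (intro Ck_on_add[OF assms(1)] Suc.IH) auto
  qed
qed

lemmas Ck_on_scaleR = Ck_on_bilinear[OF _ bounded_bilinear_scaleR]
lemmas Ck_on_inner = Ck_on_bilinear[OF _ bounded_bilinear_inner]

lemma Ck_on_diff:
  assumes "open S" "Ck_on r S f" "Ck_on r S g"
  shows "Ck_on r S (\<lambda>x. f x - g x)"
  using Ck_on_add[OF assms(1,2) Ck_on_bounded_linear[OF assms(1) bounded_linear_minus[OF bounded_linear_ident] assms(3)]]
  by simp

lemma Ck_on_compose: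
  fixes f :: "'b::euclidean_space \<Rightarrow> 'c::real_normed_vector" and g :: "'a::euclidean_space \<Rightarrow> 'b"
  assumes "open S" "Ck_on r S' f" "Ck_on r S g" "g ` S \<subseteq> S'"
  shows "Ck_on r S (\<lambda>x. f (g x))"
  using assms(2,3)
proof (induction r arbitrary: f)
  case 0
  then show ?case using assms(4) by (auto intro: continuous_on_compose2)
next
  case (Suc r)
  have gS: "g x \<in> S'" if "x \<in> S" for x using assms(4) that by auto
  let ?f' = "\<lambda>x. frechet_derivative f (at (g x))" and ?g' = "\<lambda>x. frechet_derivative g (at x)"
  show ?case
  proof (rule Ck_on_SucI[OF assms(1)])
    show "((\<lambda>x. f (g x)) has_derivative (\<lambda>v. ?f' x (?g' x v))) (at x)" if "x \<in> S" for x
      using diff_chain_at[OF Ck_on_has_derivative[OF Suc.prems(2) that]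
          Ck_on_has_derivative[OF Suc.prems(1) gS[OF that]]]
      by (simp add: o_def)
    fix v
    \<comment> \<open>\<open>Ck_on\<close> controls derivatives only in fixed directions, whereas
      the direction \<open>?g' x v\<close> moves with \<open>x\<close>. Expanding it in
      \<open>Basis\<close> turns the chain rule into a sum of products covered by the induction
      hypothesis.\<close>
    have "Ck_on r S (\<lambda>x. \<Sum>b\<in>Basis. (?g' x v \<bullet> b) *\<^sub>R ?f' x b)"
      using Suc.prems Ck_on_Suc_D[OF Suc.prems(2)]
      by (intro Ck_on_sum Ck_on_scaleR Ck_on_inner Suc.IH assms(1)) auto
    moreover have "(\<Sum>b\<in>Basis. (?g' x v \<bullet> b) *\<^sub>R ?f' x b) = ?f' x (?g' x v)" if "x \<in> S" for x
    proof -
      have L: "linear (?f' x)"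
        using Suc.prems(1) gS[OF that] by (auto intro: linear_frechet_derivative)
      show ?thesis
        by (subst (2) euclidean_representation[of "?g' x v", symmetric])
          (simp add: linear_sum[OF L] linear_cmul[OF L])
    qed
    ultimately show "Ck_on r S (\<lambda>x. ?f' x (?g' x v))"
      by (rule Ck_on_cong[OF assms(1)])
  qed
qed

text \<open>The exponent is arbitrary so that the induction can pass from \<open>a\<close> to
  \<open>a - 1\<close>; the instance used later is -1/2, for normalising vectors.\<close>

lemma Ck_on_powr: "Ck_on r {0<..} (\<lambda>t::real. t powr a)"
proof (induction r arbitrary: a)
  case 0
  then show ?case by (auto intro!: continuous_intros)
next
  case (Suc r)
  show ?case
  proof (rule Ck_on_SucI)
    show "((\<lambda>t. t powr a) has_derivative (\<lambda>v. (v * a) *\<^sub>R t powr (a - 1))) (at t)"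
      if "t \<in> {0<..}" for t :: real
      using has_real_derivative_powr[of t a] that
      by (auto simp: has_field_derivative_def mult_ac elim!: has_derivative_eq_rhs)
    show "Ck_on r {0<..} (\<lambda>t::real. (v * a) *\<^sub>R t powr (a - 1))" for v
      by (intro Ck_on_scaleR Suc) auto
  qed simp
qed

text \<open>Away from the zeros of \<open>f\<close>, the normalising factor is (f \<bullet> f) to
  the power -1/2, a composition of maps whose regularity is already known.\<close>

lemma Ck_on_sgn:
  fixes f :: "'a::euclidean_space \<Rightarrow> 'b::real_inner"
  assumes "open S" "Ck_on r S f" "\<And>x. x \<in> S \<Longrightarrow> f x \<noteq> 0"
  shows "Ck_on r S (\<lambda>x. sgn (f x))"
proof (rule Ck_on_cong[OF assms(1)])
  show "Ck_on r S (\<lambda>x. (f x \<bullet> f x) powr (-1/2) *\<^sub>R f x)"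
    using assms(3)
    by (intro Ck_on_scaleR assms(1,2) Ck_on_compose[OF _ Ck_on_powr] Ck_on_inner) auto
  show "(f x \<bullet> f x) powr (-1/2) *\<^sub>R f x = sgn (f x)" if "x \<in> S" for x
    using assms(3)[OF that]
    by (simp add: sgn_div_norm powr_minus powr_half_sqrt norm_eq_sqrt_inner)
qed

lemma smooth_on_subset: "smooth_on S f \<Longrightarrow> S' \<subseteq> S \<Longrightarrow> smooth_on S' f"
  unfolding smooth_on_def using Ck_on_subset by blast

lemma smooth_on_has_derivative:
  "smooth_on S f \<Longrightarrow> x \<in> S \<Longrightarrow> (f has_derivative frechet_derivative f (at x)) (at x)"
  unfolding smooth_on_def using Ck_on_has_derivative by blast

lemma smooth_on_frechet_derivative:
  "smooth_on S f \<Longrightarrow> smooth_on S (\<lambda>x. frechet_derivative f (at x) v)"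
  unfolding smooth_on_def by (metis Ck_on.simps(2))

lemma smooth_on_continuous: "smooth_on S f \<Longrightarrow> continuous_on S f"
  unfolding smooth_on_def by (metis Ck_on.simps(1))

lemma smooth_on_const [simp]: "smooth_on S (\<lambda>x. c)"
  by (simp add: smooth_on_def)

lemma smooth_on_cong:
  "open S \<Longrightarrow> smooth_on S f \<Longrightarrow> (\<And>x. x \<in> S \<Longrightarrow> f x = g x) \<Longrightarrow> smooth_on S g"
  unfolding smooth_on_def using Ck_on_cong by blast

lemma smooth_on_diff:
  "open S \<Longrightarrow> smooth_on S f \<Longrightarrow> smooth_on S g \<Longrightarrow> smooth_on S (\<lambda>x. f x - g x)"
  unfolding smooth_on_def using Ck_on_diff by blast

lemma smooth_on_sum:
  "open S \<Longrightarrow> (\<And>i. i \<in> I \<Longrightarrow> smooth_on S (f i)) \<Longrightarrow> smooth_on S (\<lambda>x. \<Sum>i\<in>I. f i x)"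
  by (simp add: smooth_on_def Ck_on_sum)

lemma smooth_on_scaleR:
  "open S \<Longrightarrow> smooth_on S f \<Longrightarrow> smooth_on S g \<Longrightarrow> smooth_on S (\<lambda>x. f x *\<^sub>R g x)"
  unfolding smooth_on_def using Ck_on_scaleR by blast

lemma smooth_on_inner:
  "open S \<Longrightarrow> smooth_on S f \<Longrightarrow> smooth_on S g \<Longrightarrow> smooth_on S (\<lambda>x. f x \<bullet> g x)"
  unfolding smooth_on_def using Ck_on_inner by blast

lemma smooth_on_compose:
  fixes f :: "'b::euclidean_space \<Rightarrow> 'c::real_normed_vector" and g :: "'a::euclidean_space \<Rightarrow> 'b"
  shows "open S \<Longrightarrow> smooth_on S' f \<Longrightarrow> smooth_on S g \<Longrightarrow> g ` S \<subseteq> S' \<Longrightarrow> smooth_on S (\<lambda>x. f (g x))"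
  unfolding smooth_on_def using Ck_on_compose by blast

lemma smooth_on_powr:
  assumes "open S" "smooth_on S f" "\<And>x. x \<in> S \<Longrightarrow> f x > (0::real)"
  shows "smooth_on S (\<lambda>x. f x powr a)"
proof (rule smooth_on_compose[OF assms(1) _ assms(2)])
  show "smooth_on {0<..} (\<lambda>t. t powr a)" by (simp add: smooth_on_def Ck_on_powr)
qed (use assms(3) in auto)

lemma smooth_on_sgn:
  fixes f :: "'a::euclidean_space \<Rightarrow> 'b::real_inner"
  shows "open S \<Longrightarrow> smooth_on S f \<Longrightarrow> (\<And>x. x \<in> S \<Longrightarrow> f x \<noteq> 0) \<Longrightarrow> smooth_on S (\<lambda>x. sgn (f x))"
  unfolding smooth_on_def using Ck_on_sgn by blast

section \<open>Second differences and symmetry of second derivatives\<close>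

text \<open>Two applications of the mean value theorem to a second difference.\<close>

lemma second_difference:
  fixes f :: "'a::euclidean_space \<Rightarrow> real"
  assumes "Ck_on 2 (ball x d) f" "h > 0" "h * (norm v + norm w) < d"
  obtains y where "norm (y - x) \<le> h * (norm v + norm w)"
    "f (x + h *\<^sub>R v + h *\<^sub>R w) - f (x + h *\<^sub>R v) - f (x + h *\<^sub>R w) + f x =
      h\<^sup>2 * frechet_derivative (\<lambda>z. frechet_derivative f (at z) v) (at y) w"
proof -
  let ?D = "\<lambda>z. frechet_derivative f (at z) v"
  have C: "Ck_on (Suc (Suc 0)) (ball x d) f" using assms(1) by (simp add: numeral_2_eq_2)
  then have C': "Ck_on (Suc 0) (ball x d) ?D" by simp
  have N: "norm (s *\<^sub>R v + t *\<^sub>R w) \<le> h * (norm v + norm w)" if "0 \<le> s" "s \<le> h" "0 \<le> t" "t \<le> h" for s t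
  proof -
    have "norm (s *\<^sub>R v + t *\<^sub>R w) \<le> s * norm v + t * norm w"
      using norm_triangle_ineq[of "s *\<^sub>R v" "t *\<^sub>R w"] that by simp
    also have "\<dots> \<le> h * norm v + h * norm w"
      using that by (intro add_mono mult_right_mono) auto
    finally show ?thesis by (simp add: algebra_simps)
  qed
  have B: "x + s *\<^sub>R v + t *\<^sub>R w \<in> ball x d" if "0 \<le> s" "s \<le> h" "0 \<le> t" "t \<le> h" for s t
    using N[OF that] assms(3) by (simp add: dist_norm norm_minus_commute algebra_simps)
  have d1: "((\<lambda>s. f (x + s *\<^sub>R v + t *\<^sub>R w)) has_real_derivative ?D (x + s *\<^sub>R v + t *\<^sub>R w)) (at s)"
    if "0 \<le> s" "s \<le> h" "0 \<le> t" "t \<le> h" for s t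
  proof -
    have "((\<lambda>s. x + s *\<^sub>R v + t *\<^sub>R w) has_derivative (\<lambda>r. r *\<^sub>R v)) (at s)"
      by (auto intro!: derivative_eq_intros)
    from diff_chain_at[OF this Ck_on_has_derivative[OF C B[OF that]]]
    show ?thesis
      using linear_frechet_derivative[of f "at (x + s *\<^sub>R v + t *\<^sub>R w)"] C B[OF that]
      by (auto simp: has_field_derivative_def o_def linear_cmul mult_ac elim!: has_derivative_eq_rhs)
  qed
  have d2: "((\<lambda>t. ?D (x + s *\<^sub>R v + t *\<^sub>R w)) has_real_derivative
      frechet_derivative ?D (at (x + s *\<^sub>R v + t *\<^sub>R w)) w) (at t)"
    if "0 \<le> s" "s \<le> h" "0 \<le> t" "t \<le> h" for s t
  proof -
    have "((\<lambda>t. x + s *\<^sub>R v + t *\<^sub>R w) has_derivative (\<lambda>r. r *\<^sub>R w)) (at t)"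
      by (auto intro!: derivative_eq_intros)
    from diff_chain_at[OF this Ck_on_has_derivative[OF C' B[OF that]]]
    show ?thesis
      using linear_frechet_derivative[of ?D "at (x + s *\<^sub>R v + t *\<^sub>R w)"] C' B[OF that]
      by (auto simp: has_field_derivative_def o_def linear_cmul mult_ac elim!: has_derivative_eq_rhs)
  qed
  \<comment> \<open>The term \<open>0 *\<^sub>R w\<close> is kept so that \<open>d1\<close> applies
    verbatim at both \<open>t = h\<close> and \<open>t = 0\<close>.\<close>
  let ?g = "\<lambda>s. f (x + s *\<^sub>R v + h *\<^sub>R w) - f (x + s *\<^sub>R v + 0 *\<^sub>R w)"
  have "\<exists>s. 0 < s \<and> s < h \<and>
    ?g h - ?g 0 = (h - 0) * (?D (x + s *\<^sub>R v + h *\<^sub>R w) - ?D (x + s *\<^sub>R v + 0 *\<^sub>R w))"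
    using assms(2) by (intro MVT2 DERIV_diff d1) auto
  then obtain s where s: "0 < s" "s < h"
    "?g h - ?g 0 = (h - 0) * (?D (x + s *\<^sub>R v + h *\<^sub>R w) - ?D (x + s *\<^sub>R v + 0 *\<^sub>R w))"
    by blast
  have "\<exists>t. 0 < t \<and> t < h \<and>
    ?D (x + s *\<^sub>R v + h *\<^sub>R w) - ?D (x + s *\<^sub>R v + 0 *\<^sub>R w) =
      (h - 0) * frechet_derivative ?D (at (x + s *\<^sub>R v + t *\<^sub>R w)) w"
    using assms(2) s by (intro MVT2 d2) auto
  then obtain t where t: "0 < t" "t < h"
    "?D (x + s *\<^sub>R v + h *\<^sub>R w) - ?D (x + s *\<^sub>R v + 0 *\<^sub>R w) =
      (h - 0) * frechet_derivative ?D (at (x + s *\<^sub>R v + t *\<^sub>R w)) w"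
    by blast
  show ?thesis
  proof (rule that)
    show "norm (x + s *\<^sub>R v + t *\<^sub>R w - x) \<le> h * (norm v + norm w)"
      using N[of s t] s t by (simp add: algebra_simps)
    show "f (x + h *\<^sub>R v + h *\<^sub>R w) - f (x + h *\<^sub>R v) - f (x + h *\<^sub>R w) + f x =
      h\<^sup>2 * frechet_derivative ?D (at (x + s *\<^sub>R v + t *\<^sub>R w)) w"
      using s(3) unfolding t(3) by (simp add: power2_eq_square)
  qed
qed

text \<open>The second difference is unchanged when \<open>v\<close> and \<open>w\<close> are
  exchanged, and \<open>second_difference\<close> equates it with h^2 times either mixed derivative
  at points close to \<open>x\<close>. If the mixed derivatives differed at \<open>x\<close>,
  continuity would keep these two values apart.\<close>

lemma second_derivative_symmetric_real:
  fixes f :: "'a::euclidean_space \<Rightarrow> real"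
  assumes "open S" "Ck_on 2 S f" "x \<in> S"
  shows "frechet_derivative (\<lambda>z. frechet_derivative f (at z) v) (at x) w =
         frechet_derivative (\<lambda>z. frechet_derivative f (at z) w) (at x) v" (is "?A v w x = ?A w v x")
proof (rule ccontr)
  assume ne: "?A v w x \<noteq> ?A w v x"
  define e where "e = \<bar>?A v w x - ?A w v x\<bar> / 2"
  have e: "e > 0" using ne by (simp add: e_def)
  have cont: "continuous (at x) (?A a b)" for a b
    using assms by (simp add: numeral_2_eq_2 continuous_on_eq_continuous_at)
  obtain d1 where d1: "d1 > 0" "\<And>y. dist y x < d1 \<Longrightarrow> dist (?A v w y) (?A v w x) < e"
    using cont e unfolding continuous_at_eps_delta by metis
  obtain d2 where d2: "d2 > 0" "\<And>y. dist y x < d2 \<Longrightarrow> dist (?A w v y) (?A w v x) < e"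
    using cont e unfolding continuous_at_eps_delta by metis
  obtain d3 where d3: "d3 > 0" "ball x d3 \<subseteq> S" using assms by (meson open_contains_ball)
  define d where "d = min d1 (min d2 d3)"
  \<comment> \<open>The extra 1 keeps \<open>h\<close> defined when \<open>v\<close> and
    \<open>w\<close> are both 0 and makes the bound required by \<open>second_difference\<close>
    strict.\<close>
  define h where "h = d / (norm v + norm w + 1)"
  have d: "d > 0" using d1 d2 d3 by (simp add: d_def)
  have np: "norm v + norm w + 1 > 0" by (smt (verit) norm_ge_zero)
  have h: "h > 0" using d np by (simp add: h_def)
  have "h * (norm v + norm w + 1) = d" using np by (simp add: h_def)
  then have hd: "h * (norm v + norm w) < d" using h by (simp add: algebra_simps)
  have C: "Ck_on 2 (ball x d) f"
    by (rule Ck_on_subset[OF assms(2)]) (use d3 in \<open>auto simp: d_def\<close>)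
  obtain y where y: "norm (y - x) \<le> h * (norm v + norm w)"
    "f (x + h *\<^sub>R v + h *\<^sub>R w) - f (x + h *\<^sub>R v) - f (x + h *\<^sub>R w) + f x = h\<^sup>2 * ?A v w y"
    using second_difference[OF C h hd] by blast
  obtain z where z: "norm (z - x) \<le> h * (norm w + norm v)"
    "f (x + h *\<^sub>R w + h *\<^sub>R v) - f (x + h *\<^sub>R w) - f (x + h *\<^sub>R v) + f x = h\<^sup>2 * ?A w v z"
    using second_difference[OF C h, of w v] hd by (auto simp: add.commute)
  have "h\<^sup>2 * ?A v w y = h\<^sup>2 * ?A w v z"
    using y(2) z(2) by (simp add: algebra_simps)
  then have "?A v w y = ?A w v z" using h by simp
  moreover have "dist (?A v w y) (?A v w x) < e"
    using y(1) hd by (intro d1) (auto simp: dist_norm d_def)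
  moreover have "dist (?A w v z) (?A w v x) < e"
    using z(1) hd by (intro d2) (auto simp: dist_norm d_def add.commute)
  ultimately have "\<bar>?A v w x - ?A w v x\<bar> < e + e"
    unfolding dist_real_def by linarith
  then show False by (simp add: e_def)
qed

text \<open>The mean value theorem behind the real case does not hold for vector values, so the
  identity is checked on components.\<close>

lemma second_derivative_symmetric:
  fixes f :: "'a::euclidean_space \<Rightarrow> 'b::euclidean_space"
  assumes "open S" "Ck_on 2 S f" "x \<in> S"
  shows "frechet_derivative (\<lambda>z. frechet_derivative f (at z) v) (at x) w =
         frechet_derivative (\<lambda>z. frechet_derivative f (at z) w) (at x) v"
proof (rule euclidean_eqI)
  fix b :: 'b
  have C: "Ck_on (Suc (Suc 0)) S f" using assms by (simp add: numeral_2_eq_2)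
  have 1: "frechet_derivative (\<lambda>z. f z \<bullet> b) (at y) = (\<lambda>u. frechet_derivative f (at y) u \<bullet> b)"
    if "y \<in> S" for y
    by (rule frechet_derivative_at[OF has_derivative_inner_left[OF Ck_on_has_derivative[OF C that]], symmetric])
  have 2: "frechet_derivative (\<lambda>z. frechet_derivative (\<lambda>z. f z \<bullet> b) (at z) v) (at x) w =
      frechet_derivative (\<lambda>z. frechet_derivative f (at z) v) (at x) w \<bullet> b" for v w
  proof -
    let ?D = "\<lambda>z. frechet_derivative f (at z) v"
    have "(?D has_derivative frechet_derivative ?D (at x)) (at x)"
      using C assms(3) by (intro Ck_on_has_derivative[of 0 S]) auto
    from has_derivative_inner_left[OF this, of b]
    have "((\<lambda>z. frechet_derivative (\<lambda>z. f z \<bullet> b) (at z) v) has_derivative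
        (\<lambda>u. frechet_derivative ?D (at x) u \<bullet> b)) (at x)"
      by (rule has_derivative_transform_within_open[OF _ assms(1,3)]) (simp add: 1)
    then show ?thesis by (rule fun_cong[OF frechet_derivative_at, symmetric])
  qed
  have "Ck_on 2 S (\<lambda>z. f z \<bullet> b)"
    by (rule Ck_on_bounded_linear[OF assms(1) bounded_linear_inner_left assms(2)])
  from second_derivative_symmetric_real[OF assms(1) this assms(3), of v w]
  show "frechet_derivative (\<lambda>z. frechet_derivative f (at z) v) (at x) w \<bullet> b =
      frechet_derivative (\<lambda>z. frechet_derivative f (at z) w) (at x) v \<bullet> b"
    unfolding 2 .
qed

section \<open>The drift Laplacian in coordinates\<close>

abbreviation fderiv :: "('a::euclidean_space \<Rightarrow> 'b::real_normed_vector) \<Rightarrow> 'a \<Rightarrow> 'a \<Rightarrow> 'b"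
  where "fderiv f x \<equiv> frechet_derivative f (at x)"

abbreviation fderiv2 :: "('a::euclidean_space \<Rightarrow> 'b::real_normed_vector) \<Rightarrow> 'a \<Rightarrow> 'a \<Rightarrow> 'a \<Rightarrow> 'b"
  where "fderiv2 f x v w \<equiv> fderiv (\<lambda>z. fderiv f z v) x w"

lemma Ck_on_2_has_derivative:
  assumes "Ck_on 2 S f" "x \<in> S"
  shows "(f has_derivative fderiv f x) (at x)"
    and "((\<lambda>z. fderiv f z v) has_derivative fderiv2 f x v) (at x)"
  using assms by (auto simp: numeral_2_eq_2 frechet_derivative_works[symmetric])

text \<open>With \<open>w = - v\<close> the second difference becomes 2 f(x) - f(x + h v) - f(x - h
  v). It is nonpositive at a minimum and equals -h^2 times the second derivative along
  \<open>v\<close> at a nearby point, whereas a negative second derivative at \<open>x\<close> would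
  stay negative nearby.\<close>

lemma second_derivative_test:
  fixes f :: "'a::euclidean_space \<Rightarrow> real"
  assumes "open S" "Ck_on 2 S f" "x \<in> S" "\<And>y. y \<in> S \<Longrightarrow> f x \<le> f y"
  shows "fderiv f x v = 0" and "fderiv2 f x v v \<ge> 0"
proof -
  have "fderiv f x = (\<lambda>v. 0)"
    using has_derivative_local_min[OF Ck_on_2_has_derivative(1)[OF assms(2,3)]]
      eventually_at_in_open'[OF assms(1,3)] assms(4)
    by (metis (mono_tags, lifting) eventually_mono)
  then show "fderiv f x v = 0" by simp
  show "fderiv2 f x v v \<ge> 0"
  proof (rule ccontr)
    assume neg: "\<not> fderiv2 f x v v \<ge> 0"
    have "continuous (at x) (\<lambda>y. fderiv2 f y v v)"
      using assms by (simp add: numeral_2_eq_2 continuous_on_eq_continuous_at)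
    then obtain d1 where d1: "d1 > 0"
      "\<And>y. dist y x < d1 \<Longrightarrow> dist (fderiv2 f y v v) (fderiv2 f x v v) < - fderiv2 f x v v"
      using neg unfolding continuous_at_eps_delta by (metis neg_0_less_iff_less not_le)
    obtain d2 where d2: "d2 > 0" "ball x d2 \<subseteq> S" using assms by (meson open_contains_ball)
    define d where "d = min d1 d2"
    define h where "h = d / (norm v + norm (- v) + 1)"
    have d: "d > 0" using d1 d2 by (simp add: d_def)
    have np: "norm v + norm (- v) + 1 > 0" by (smt (verit) norm_ge_zero)
    have h: "h > 0" using d np by (simp add: h_def)
    have "h * (norm v + norm (- v) + 1) = d" using np by (simp add: h_def)
    then have hd: "h * (norm v + norm (- v)) < d" using h by (simp add: algebra_simps)
    have C: "Ck_on 2 (ball x d) f"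
      by (rule Ck_on_subset[OF assms(2)]) (use d2 in \<open>auto simp: d_def\<close>)
    obtain y where y: "norm (y - x) \<le> h * (norm v + norm (- v))"
      "f (x + h *\<^sub>R v + h *\<^sub>R (- v)) - f (x + h *\<^sub>R v) - f (x + h *\<^sub>R (- v)) + f x =
        h\<^sup>2 * fderiv2 f y v (- v)"
      using second_difference[OF C h hd] by blast
    have yb: "dist y x < d" using y(1) hd by (simp add: dist_norm)
    then have yS: "y \<in> S" using d2 by (auto simp: d_def dist_commute)
    have "h * (norm v + norm (- v)) = h * norm v + h * norm v" by (simp add: distrib_left)
    moreover have "h * norm v \<ge> 0" using h by simp
    ultimately have hv: "h * norm v < d" using hd by linarith
    have "x + h *\<^sub>R v \<in> S" "x + h *\<^sub>R (- v) \<in> S"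
      using d2 hv h by (auto simp: d_def dist_norm intro!: subsetD[OF d2(2)])
    then have "f x \<le> f (x + h *\<^sub>R v)" "f x \<le> f (x + h *\<^sub>R (- v))" using assms(4) by auto
    moreover have x: "x + h *\<^sub>R v + h *\<^sub>R (- v) = x" by simp
    ultimately have "h\<^sup>2 * fderiv2 f y v (- v) \<le> 0"
      using y(2) unfolding x by linarith
    then have "fderiv2 f y v (- v) \<le> 0" using h by (simp add: mult_le_0_iff)
    moreover have "fderiv2 f y v (- v) = - fderiv2 f y v v"
      using has_derivative_linear[OF Ck_on_2_has_derivative(2)[OF assms(2) yS]] linear_neg by blast
    ultimately have "fderiv2 f y v v \<ge> 0" by simp
    moreover have "dist (fderiv2 f y v v) (fderiv2 f x v v) < - fderiv2 f x v v"
      using yb by (intro d1) (simp add: d_def)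
    ultimately show False by (simp add: dist_real_def)
  qed
qed

text \<open>The matrix \<open>a\<close> expresses the orthonormal fields in terms of the given ones, so that
  coordinate fields orthonormalised in the image also yield smooth fields in the domain.\<close>

lemma smooth_gram_schmidt:
  fixes E :: "'i \<Rightarrow> 'a::euclidean_space \<Rightarrow> 'b::euclidean_space"
  assumes "finite I" "open S" "x0 \<in> S" "\<And>i. i \<in> I \<Longrightarrow> smooth_on S (E i)"
    and "\<And>c. (\<Sum>i\<in>I. c i *\<^sub>R E i x0) = 0 \<Longrightarrow> \<forall>i\<in>I. c i = 0"
  shows "\<exists>U e a. open U \<and> x0 \<in> U \<and> U \<subseteq> S \<and>
    (\<forall>i\<in>I. smooth_on U (e i)) \<and> (\<forall>i\<in>I. \<forall>l\<in>I. smooth_on U (a i l)) \<and>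
    (\<forall>x\<in>U. \<forall>i\<in>I. e i x = (\<Sum>l\<in>I. a i l x *\<^sub>R E l x)) \<and>
    (\<forall>x\<in>U. \<forall>i\<in>I. \<forall>j\<in>I. e i x \<bullet> e j x = (if i = j then 1 else 0))"
proof -
  have "\<forall>i\<in>I. smooth_on S (E i)" "\<forall>c. (\<Sum>i\<in>I. c i *\<^sub>R E i x0) = 0 \<longrightarrow> (\<forall>i\<in>I. c i = 0)"
    using assms(4,5) by auto
  with assms(1) show ?thesis
  proof (induction I rule: finite_induct)
    case empty
    then show ?case using assms(2,3) by auto
  next
    case (insert k I)
    have smI: "\<forall>i\<in>I. smooth_on S (E i)" using insert.prems(1) by simp
    have indep: "\<forall>c. (\<Sum>i\<in>I. c i *\<^sub>R E i x0) = 0 \<longrightarrow> (\<forall>i\<in>I. c i = 0)"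
    proof (intro allI impI)
      fix c :: "'i \<Rightarrow> real"
      assume that: "(\<Sum>i\<in>I. c i *\<^sub>R E i x0) = 0"
      have "(\<Sum>i\<in>I. (c(k := 0)) i *\<^sub>R E i x0) = (\<Sum>i\<in>I. c i *\<^sub>R E i x0)"
        using insert.hyps(2) by (intro sum.cong) auto
      then have "(\<Sum>i\<in>insert k I. (c(k := 0)) i *\<^sub>R E i x0) = 0"
        using insert.hyps that by simp
      then have "\<forall>i\<in>insert k I. (c(k := 0)) i = 0" using insert.prems(2) by blast
      then show "\<forall>i\<in>I. c i = 0" using insert.hyps(2) by (metis fun_upd_other insertCI)
    qed
    obtain U e a where U: "open U" "x0 \<in> U" "U \<subseteq> S"
      and "\<forall>i\<in>I. smooth_on U (e i)" "\<forall>i\<in>I. \<forall>l\<in>I. smooth_on U (a i l)"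
        "\<forall>x\<in>U. \<forall>i\<in>I. e i x = (\<Sum>l\<in>I. a i l x *\<^sub>R E l x)"
        "\<forall>x\<in>U. \<forall>i\<in>I. \<forall>j\<in>I. e i x \<bullet> e j x = (if i = j then 1 else 0)"
      using insert.IH[OF smI indep] by (elim exE conjE) (rule that)
    then have e: "\<And>i. i \<in> I \<Longrightarrow> smooth_on U (e i)"
      and a: "\<And>i l. i \<in> I \<Longrightarrow> l \<in> I \<Longrightarrow> smooth_on U (a i l)"
      and ea: "\<And>x i. x \<in> U \<Longrightarrow> i \<in> I \<Longrightarrow> e i x = (\<Sum>l\<in>I. a i l x *\<^sub>R E l x)"
      and orth: "\<And>x i j. x \<in> U \<Longrightarrow> i \<in> I \<Longrightarrow> j \<in> I \<Longrightarrow> e i x \<bullet> e j x = (if i = j then 1 else 0)"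
      by blast+
    have Ek: "smooth_on U (E k)" by (rule smooth_on_subset[OF _ U(3)]) (use insert.prems(1) in simp)
    \<comment> \<open>\<open>r\<close> is \<open>E k\<close> minus its projection onto the fields
      already built; \<open>m\<close> lists the coefficients of that projection with respect to the
      original fields \<open>E l\<close>.\<close>
    define m where "m l x = (\<Sum>i\<in>I. (E k x \<bullet> e i x) *\<^sub>R a i l x)" for l x
    define r where "r x = E k x - (\<Sum>i\<in>I. (E k x \<bullet> e i x) *\<^sub>R e i x)" for x
    have sr: "smooth_on U r"
      unfolding r_def using U(1) Ek e
      by (intro smooth_on_diff smooth_on_sum smooth_on_scaleR smooth_on_inner) auto
    have sm: "smooth_on U (m l)" if "l \<in> I" for l
      unfolding m_def using U(1) Ek e a that
      by (intro smooth_on_sum smooth_on_scaleR smooth_on_inner) auto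
    have r: "r x = E k x - (\<Sum>l\<in>I. m l x *\<^sub>R E l x)" if "x \<in> U" for x
    proof -
      have "(\<Sum>i\<in>I. (E k x \<bullet> e i x) *\<^sub>R e i x) = (\<Sum>i\<in>I. \<Sum>l\<in>I. ((E k x \<bullet> e i x) * a i l x) *\<^sub>R E l x)"
        using ea[OF that] by (simp add: scaleR_sum_right)
      also have "\<dots> = (\<Sum>l\<in>I. m l x *\<^sub>R E l x)"
        by (subst sum.swap) (simp add: m_def scaleR_sum_left)
      finally show ?thesis by (simp add: r_def)
    qed
    have r0: "r x0 \<noteq> 0"
    proof
      assume "r x0 = 0"
      define c where "c = (\<lambda>i. if i = k then 1 else - m i x0)"
      have "(\<Sum>i\<in>I. c i *\<^sub>R E i x0) = (\<Sum>i\<in>I. - (m i x0 *\<^sub>R E i x0))"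
        using insert.hyps(2) by (intro sum.cong) (auto simp: c_def)
      then have "(\<Sum>i\<in>insert k I. c i *\<^sub>R E i x0) = 0"
        using insert.hyps r[OF U(2)] \<open>r x0 = 0\<close> by (simp add: c_def sum_negf)
      then have "c k = 0" using insert.prems(2) by blast
      then show False by (simp add: c_def)
    qed
    have rorth: "r x \<bullet> e i x = 0" if "x \<in> U" "i \<in> I" for x i
      using that orth[OF that(1)] insert.hyps(1)
      by (simp add: r_def inner_diff_left inner_sum_left if_distrib[of "\<lambda>t. _ * t"] cong: if_cong)
    \<comment> \<open>Independence is assumed at \<open>x0\<close> only, so \<open>r\<close> is
      known to be nonzero only there; continuity provides the smaller neighbourhood.\<close>
    define U' where "U' = U \<inter> r -` (- {0})"
    have U': "open U'" "x0 \<in> U'" "U' \<subseteq> U"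
      using continuous_open_preimage[OF smooth_on_continuous[OF sr] U(1), of "- {0}"] r0 U(2)
      by (auto simp: U'_def)
    define N where "N x = (r x \<bullet> r x) powr (-1/2)" for x
    have sN: "smooth_on U' N"
      unfolding N_def using U' by (intro smooth_on_powr smooth_on_inner smooth_on_subset[OF sr]) (auto simp: U'_def)
    have N: "N x * N x * (r x \<bullet> r x) = 1" if "x \<in> U'" for x
    proof -
      have "r x \<bullet> r x > 0" using that by (simp add: U'_def)
      then show ?thesis by (simp add: N_def flip: powr_add)
    qed
    define e' where "e' i = (if i = k then (\<lambda>x. N x *\<^sub>R r x) else e i)" for i
    \<comment> \<open>The old fields get coefficient 0 on \<open>E k\<close>. The negative is
      written \<open>0 - m l x\<close> so that \<open>smooth_on_diff\<close> applies.\<close>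
    define a' where "a' i l = (if i = k then (if l = k then N else (\<lambda>x. N x *\<^sub>R (0 - m l x)))
      else if l = k then (\<lambda>x. 0) else a i l)" for i l
    show ?case
    proof (intro exI[of _ U'] exI[of _ e'] exI[of _ a'] conjI ballI)
      show "open U'" "x0 \<in> U'" "U' \<subseteq> S" using U' U by auto
      show "smooth_on U' (e' i)" if "i \<in> insert k I" for i
        using that smooth_on_scaleR[OF U'(1) sN smooth_on_subset[OF sr U'(3)]]
          smooth_on_subset[OF e U'(3)] by (auto simp: e'_def)
      show "smooth_on U' (a' i l)" if "i \<in> insert k I" "l \<in> insert k I" for i l
      proof -
        have "smooth_on U' (\<lambda>x. N x *\<^sub>R (0 - m l x))" if "l \<in> I"
          using smooth_on_subset[OF sm[OF that] U'(3)]
          by (intro smooth_on_scaleR sN smooth_on_diff U') auto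
        then show ?thesis using that sN smooth_on_subset[OF a U'(3)]
          by (auto simp: a'_def)
      qed
      show "e' i x = (\<Sum>l\<in>insert k I. a' i l x *\<^sub>R E l x)" if "x \<in> U'" "i \<in> insert k I" for x i
      proof (cases "i = k")
        case True
        have "(\<Sum>l\<in>I. a' k l x *\<^sub>R E l x) = (\<Sum>l\<in>I. - (N x *\<^sub>R m l x *\<^sub>R E l x))"
          using insert.hyps(2) by (intro sum.cong) (auto simp: a'_def)
        then have "(\<Sum>l\<in>insert k I. a' k l x *\<^sub>R E l x) = N x *\<^sub>R (E k x - (\<Sum>l\<in>I. m l x *\<^sub>R E l x))"
          using insert.hyps by (simp add: a'_def sum_negf scaleR_diff_right scaleR_sum_right)
        then show ?thesis using True r[of x] that U'(3) by (auto simp: e'_def)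
      next
        case False
        have "(\<Sum>l\<in>I. a' i l x *\<^sub>R E l x) = (\<Sum>l\<in>I. a i l x *\<^sub>R E l x)"
          using insert.hyps(2) False by (intro sum.cong) (auto simp: a'_def)
        then show ?thesis using False that U'(3) ea[of x i] insert.hyps
          by (auto simp: e'_def a'_def)
      qed
      show "e' i x \<bullet> e' j x = (if i = j then 1 else 0)"
        if "x \<in> U'" "i \<in> insert k I" "j \<in> insert k I" for x i j
        using that rorth[of x] orth[of x] N[of x] U'(3) insert.hyps(2)
        by (auto simp: e'_def inner_commute mult.assoc)
    qed
  qed
qed

text \<open>The product rule for a derivative taken along a moving field \<open>V\<close>, needed
  because the frame vectors DG(v_j) are themselves differentiated. Expansion in \<open>Basis\<close>
  leads back to second derivatives in fixed directions.\<close>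

lemma has_derivative_fderiv_apply:
  fixes G :: "'a::euclidean_space \<Rightarrow> 'b::real_normed_vector" and V :: "'a \<Rightarrow> 'a"
  assumes "open S" "Ck_on 2 S G" "x \<in> S" "(V has_derivative V') (at x)"
  shows "((\<lambda>z. fderiv G z (V z)) has_derivative
           (\<lambda>w. fderiv2 G x (V x) w + fderiv G x (V' w))) (at x)"
proof -
  have lin: "linear (fderiv G z)" if "z \<in> S" for z
    using has_derivative_linear[OF Ck_on_2_has_derivative(1)[OF assms(2) that]] .
  have rep: "(\<Sum>b\<in>Basis. (u \<bullet> b) *\<^sub>R fderiv G z b) = fderiv G z u" if "z \<in> S" for z u
    by (subst (2) euclidean_representation[of u, symmetric])
      (simp add: linear_sum[OF lin[OF that]] linear_cmul[OF lin[OF that]])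
  have D2: "((\<lambda>z. \<Sum>b\<in>Basis. (V x \<bullet> b) *\<^sub>R fderiv G z b) has_derivative
      (\<lambda>w. \<Sum>b\<in>Basis. (V x \<bullet> b) *\<^sub>R fderiv2 G x b w)) (at x)"
    by (intro has_derivative_sum has_derivative_scaleR_right Ck_on_2_has_derivative(2)[OF assms(2,3)])
  have "((\<lambda>z. fderiv G z (V x)) has_derivative
      (\<lambda>w. \<Sum>b\<in>Basis. (V x \<bullet> b) *\<^sub>R fderiv2 G x b w)) (at x)"
    by (rule has_derivative_transform_within_open[OF D2 assms(1,3)]) (rule rep)
  from fun_cong[OF frechet_derivative_at[OF this]]
  have rep2: "fderiv2 G x (V x) w = (\<Sum>b\<in>Basis. (V x \<bullet> b) *\<^sub>R fderiv2 G x b w)" for w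
    by simp
  have "((\<lambda>z. \<Sum>b\<in>Basis. (V z \<bullet> b) *\<^sub>R fderiv G z b) has_derivative
      (\<lambda>w. \<Sum>b\<in>Basis. (V x \<bullet> b) *\<^sub>R fderiv2 G x b w + (V' w \<bullet> b) *\<^sub>R fderiv G x b)) (at x)"
    by (intro has_derivative_sum has_derivative_scaleR Ck_on_2_has_derivative(2)[OF assms(2,3)]
        has_derivative_inner_left assms(4))
  then have "((\<lambda>z. fderiv G z (V z)) has_derivative
      (\<lambda>w. \<Sum>b\<in>Basis. (V x \<bullet> b) *\<^sub>R fderiv2 G x b w + (V' w \<bullet> b) *\<^sub>R fderiv G x b)) (at x)"
    by (rule has_derivative_transform_within_open[OF _ assms(1,3)]) (rule rep)
  then show ?thesis
    by (simp add: rep2 rep[OF assms(3)] sum.distrib)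
qed

section \<open>Shape operator and Simons-type identity\<close>

text \<open>The source of the geometric identities below: orthonormality, normality, symmetry of the
  second fundamental form and the trace formula are scalar relations on an open set, and each is
  differentiated with derivative zero.\<close>

lemma derivative_of_constant:
  assumes "open S" "x \<in> S" "(f has_derivative f') (at x)" "\<And>y. y \<in> S \<Longrightarrow> f y = c"
  shows "f' w = 0"
proof -
  have "((\<lambda>y. c) has_derivative f') (at x)"
    by (rule has_derivative_transform_within_open[OF assms(3,1,2)]) (rule assms(4))
  then show ?thesis
    using has_derivative_unique[OF has_derivative_const] by (metis)
qed

text \<open>Weingarten's equation, obtained by differentiating \<xi> \<bullet> DG(c) = 0 in the
  direction \<open>a\<close>.\<close>

lemma shape_operator_inner:
  assumes "open S" "Ck_on 2 S G" and dxi: "(\<xi> has_derivative \<xi>') (at x)"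
    and normal: "\<And>y w. y \<in> S \<Longrightarrow> \<xi> y \<bullet> fderiv G y w = 0" and "x \<in> S"
  shows "\<xi>' a \<bullet> fderiv G x c = - (\<xi> x \<bullet> fderiv2 G x c a)"
  using derivative_of_constant[OF assms(1,5) has_derivative_inner[OF dxi
        Ck_on_2_has_derivative(2)[OF assms(2,5), of c]], of 0 a] normal by simp

text \<open>In the trace of Weingarten's equation the tangential term DG(b) is annihilated by \<xi>
  and only W survives. As the result holds at every point of \<open>S\<close>, it can be
  differentiated again.\<close>

lemma trace_shape_operator:
  fixes G \<xi> :: "'a::euclidean_space \<Rightarrow> 'b::euclidean_space" and v :: "'i::finite \<Rightarrow> 'a \<Rightarrow> 'a"
  assumes S: "open S" and CG: "Ck_on 2 S G" and Cxi: "Ck_on 2 S \<xi>"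
    and normal: "\<And>y w. y \<in> S \<Longrightarrow> \<xi> y \<bullet> fderiv G y w = 0"
    and soliton: "\<And>y. y \<in> S \<Longrightarrow> \<exists>b. (\<Sum>j\<in>UNIV. fderiv2 G y (v j y) (v j y)) = fderiv G y b - W"
    and "y \<in> S"
  shows "(\<Sum>j\<in>UNIV. fderiv \<xi> y (v j y) \<bullet> fderiv G y (v j y)) = \<xi> y \<bullet> W"
proof -
  obtain b where b: "(\<Sum>j\<in>UNIV. fderiv2 G y (v j y) (v j y)) = fderiv G y b - W"
    using soliton[OF \<open>y \<in> S\<close>] by blast
  have "(\<Sum>j\<in>UNIV. fderiv \<xi> y (v j y) \<bullet> fderiv G y (v j y)) =
      - (\<xi> y \<bullet> (\<Sum>j\<in>UNIV. fderiv2 G y (v j y) (v j y)))"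
    by (simp add: shape_operator_inner[OF S CG Ck_on_2_has_derivative(1)[OF Cxi \<open>y \<in> S\<close>] normal \<open>y \<in> S\<close>]
        inner_sum_right sum_negf)
  then show ?thesis
    by (simp add: b inner_diff_right normal[OF \<open>y \<in> S\<close>])
qed

lemma orthonormal_expansion:
  fixes e :: "'i::finite \<Rightarrow> 'a::euclidean_space"
  assumes "orthonormal_family e" "y \<in> span (range e)"
  shows "(\<Sum>j\<in>UNIV. (y \<bullet> e j) *\<^sub>R e j) = y"
proof -
  have o: "e i \<bullet> e j = (if i = j then 1 else 0)" for i j
    using assms(1) by (simp add: orthonormal_family_def)
  have "inj e" by (rule injI) (metis o zero_neq_one)
  moreover obtain c' where "y = (\<Sum>z\<in>range e. c' z *\<^sub>R z)"
    using assms(2) by (auto simp: span_finite)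
  ultimately obtain c where c: "y = (\<Sum>j\<in>UNIV. c j *\<^sub>R e j)"
    by (simp add: sum.reindex)
  have "y \<bullet> e j = c j" for j
    by (simp add: c inner_sum_left o if_distrib[of "\<lambda>t. _ * t"] cong: if_cong)
  then show ?thesis using c by simp
qed

text \<open>The local representative of a translating soliton with parallel unit normal \<open>\<xi>\<close>: the
  vectors \<open>v j\<close> form an orthonormal frame in the coordinate space, \<open>u = \<xi> \<bullet> W\<close> is the mean
  curvature, and \<open>L f = (\<Sum>j. fderiv2 f x (v j) (v j)) - fderiv f x b\<close> is the drift Laplacian,
  for which \<open>L G = - W\<close>.  The Simons-type identity \<open>L u = - u * |A|\<^sup>2\<close> then needs only second
  derivatives of \<open>G\<close>.\<close>

lemma drift_laplacian_mean_curvature: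
  fixes G \<xi> :: "'a::euclidean_space \<Rightarrow> 'b::euclidean_space" and v :: "'i::finite \<Rightarrow> 'a \<Rightarrow> 'a"
  assumes S: "open S" "x \<in> S" and CG: "Ck_on 2 S G" and Cxi: "Ck_on 2 S \<xi>"
    and dv: "\<And>j. v j differentiable (at x)"
    and orth: "\<And>y i j. y \<in> S \<Longrightarrow> fderiv G y (v i y) \<bullet> fderiv G y (v j y) = (if i = j then 1 else 0)"
    and span: "range (fderiv G x) \<subseteq> span (range (\<lambda>j. fderiv G x (v j x)))"
    and normal: "\<And>y w. y \<in> S \<Longrightarrow> \<xi> y \<bullet> fderiv G y w = 0"
    and unit: "\<And>y. y \<in> S \<Longrightarrow> \<xi> y \<bullet> \<xi> y = 1"
    and parallel: "\<And>w. fderiv \<xi> x w \<in> range (fderiv G x)"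
    and W: "W - (\<xi> x \<bullet> W) *\<^sub>R \<xi> x \<in> range (fderiv G x)"
    and soliton: "\<And>y. y \<in> S \<Longrightarrow> \<exists>b. (\<Sum>j\<in>UNIV. fderiv2 G y (v j y) (v j y)) = fderiv G y b - W"
    and b: "(\<Sum>j\<in>UNIV. fderiv2 G x (v j x) (v j x)) = fderiv G x b - W"
  shows "(\<Sum>j\<in>UNIV. fderiv2 \<xi> x (v j x) (v j x) \<bullet> W) - fderiv \<xi> x b \<bullet> W =
    - (\<xi> x \<bullet> W) * (\<Sum>j\<in>UNIV. (norm (fderiv \<xi> x (v j x)))\<^sup>2)"
proof -
  \<comment> \<open>\<open>w\<close> represents the tangential part of \<open>W\<close>. Pairing the
    second derivatives of \<xi> with \<open>W\<close> splits accordingly into a tangential and a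
    normal contribution.\<close>
  obtain w where w: "W - (\<xi> x \<bullet> W) *\<^sub>R \<xi> x = fderiv G x w" using W by auto
  have dG: "(G has_derivative fderiv G y) (at y)"
    and d2G: "((\<lambda>z. fderiv G z a) has_derivative fderiv2 G y a) (at y)" if "y \<in> S" for y a
    using Ck_on_2_has_derivative[OF CG that] by auto
  have dxi: "(\<xi> has_derivative fderiv \<xi> y) (at y)"
    and d2xi: "((\<lambda>z. fderiv \<xi> z a) has_derivative fderiv2 \<xi> y a) (at y)" if "y \<in> S" for y a
    using Ck_on_2_has_derivative[OF Cxi that] by auto
  define dV where "dV j = frechet_derivative (v j) (at x)" for j
  have dV: "(v j has_derivative dV j) (at x)" for j
    using dv by (simp add: dV_def frechet_derivative_works[symmetric])
  have symG: "fderiv2 G y a c = fderiv2 G y c a" if "y \<in> S" for y a c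
    by (rule second_derivative_symmetric[OF S(1) CG that])
  have symxi: "fderiv2 \<xi> y a c = fderiv2 \<xi> y c a" if "y \<in> S" for y a c
    by (rule second_derivative_symmetric[OF S(1) Cxi that])
  have h: "fderiv \<xi> y a \<bullet> fderiv G y c = - (\<xi> y \<bullet> fderiv2 G y c a)" if "y \<in> S" for y a c
    by (rule shape_operator_inner[OF S(1) CG Ck_on_2_has_derivative(1)[OF Cxi that] normal that])
  have hsym: "fderiv \<xi> y a \<bullet> fderiv G y c = fderiv \<xi> y c \<bullet> fderiv G y a" if "y \<in> S" for y a c
    using h[OF that, of a c] h[OF that, of c a] symG[OF that, of a c] by simp
  have trace: "(\<Sum>j\<in>UNIV. fderiv \<xi> y (v j y) \<bullet> fderiv G y (v j y)) = \<xi> y \<bullet> W" if "y \<in> S" for y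
    by (rule trace_shape_operator[OF S(1) CG Cxi normal soliton that])
  have xi_dxi: "fderiv \<xi> y a \<bullet> \<xi> y = 0" if "y \<in> S" for y a
    using derivative_of_constant[OF S(1) that
        has_derivative_inner[OF dxi[OF that] dxi[OF that]], of 1 a] unit
    by (simp add: inner_commute)
  \<comment> \<open>The Codazzi equation: the symmetry \<open>hsym\<close> is differentiated in
    fixed coordinate directions, so that no third derivative of \<open>G\<close> appears.\<close>
  have codazzi: "fderiv2 \<xi> x a d \<bullet> fderiv G x c + fderiv \<xi> x a \<bullet> fderiv2 G x c d =
      fderiv2 \<xi> x c d \<bullet> fderiv G x a + fderiv \<xi> x c \<bullet> fderiv2 G x a d" for a c d
    using derivative_of_constant[OF S has_derivative_diff[OF
          has_derivative_inner[OF d2xi[OF S(2), of a] d2G[OF S(2), of c]]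
          has_derivative_inner[OF d2xi[OF S(2), of c] d2G[OF S(2), of a]]], of 0 d] hsym
    by simp
  let ?v = "\<lambda>j. v j x"
  let ?e = "\<lambda>j. fderiv G x (?v j)"
  \<comment> \<open>The derivative of the frame vector \<open>?e i\<close> along \<open>w\<close>
    has two sources: the motion of the field \<open>v i\<close>, recorded by \<open>P\<close>, and
    the change of DG, recorded by \<open>Q\<close>. \<open>H\<close> is the matrix of the shape
    operator.\<close>
  define P where "P i j = fderiv G x (dV i w) \<bullet> ?e j" for i j
  define Q where "Q i j = fderiv2 G x (?v i) w \<bullet> ?e j" for i j
  define H where "H i j = fderiv \<xi> x (?v i) \<bullet> ?e j" for i j
  have dG_v: "((\<lambda>z. fderiv G z (v j z)) has_derivative
      (\<lambda>a. fderiv2 G x (?v j) a + fderiv G x (dV j a))) (at x)" for j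
    by (rule has_derivative_fderiv_apply[OF S(1) CG S(2) dV])
  have dxi_v: "((\<lambda>z. fderiv \<xi> z (v j z)) has_derivative
      (\<lambda>a. fderiv2 \<xi> x (?v j) a + fderiv \<xi> x (dV j a))) (at x)" for j
    by (rule has_derivative_fderiv_apply[OF S(1) Cxi S(2) dV])
  \<comment> \<open>Differentiated orthonormality: \<open>P\<close> + \<open>Q\<close> is
    antisymmetric.\<close>
  have PQ: "P i j + P j i + Q i j + Q j i = 0" for i j
    using derivative_of_constant[OF S has_derivative_inner[OF dG_v[of i] dG_v[of j]],
        of "if i = j then 1 else 0" w] orth
    by (simp add: P_def Q_def inner_add_left inner_add_right inner_commute)
  have Hsym: "H i j = H j i" for i j by (simp add: H_def hsym[OF S(2)])
  have "orthonormal_family ?e" using orth[OF S(2)] by (simp add: orthonormal_family_def)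
  then have expand: "y = (\<Sum>j\<in>UNIV. (y \<bullet> ?e j) *\<^sub>R ?e j)" if "y \<in> range (fderiv G x)" for y
    using orthonormal_expansion[of ?e y] that span by auto
  \<comment> \<open>Here parallelism enters: the derivative of \<xi> is tangent, so pairing it with
    any \<open>y\<close> sees only the frame components of \<open>y\<close>.\<close>
  have shape: "fderiv \<xi> x (?v j) \<bullet> y = (\<Sum>l\<in>UNIV. H j l * (y \<bullet> ?e l))" for j y
    by (subst expand[OF parallel]) (simp add: inner_sum_left H_def inner_commute[of y])
  have dtrace: "(\<Sum>j\<in>UNIV. fderiv \<xi> x (?v j) \<bullet> (fderiv2 G x (?v j) w + fderiv G x (dV j w)) +
      (fderiv2 \<xi> x (?v j) w + fderiv \<xi> x (dV j w)) \<bullet> ?e j) - fderiv \<xi> x w \<bullet> W = 0"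
  proof (rule derivative_of_constant[OF S])
    show "((\<lambda>z. (\<Sum>j\<in>UNIV. fderiv \<xi> z (v j z) \<bullet> fderiv G z (v j z)) - \<xi> z \<bullet> W) has_derivative
      (\<lambda>a. (\<Sum>j\<in>UNIV. fderiv \<xi> x (?v j) \<bullet> (fderiv2 G x (?v j) a + fderiv G x (dV j a)) +
      (fderiv2 \<xi> x (?v j) a + fderiv \<xi> x (dV j a)) \<bullet> ?e j) - fderiv \<xi> x a \<bullet> W)) (at x)"
      by (intro has_derivative_diff has_derivative_sum has_derivative_inner
          has_derivative_inner_left dxi dG_v dxi_v S)
  qed (use trace in simp)
  have PH: "fderiv \<xi> x (?v j) \<bullet> fderiv G x (dV j w) = (\<Sum>l\<in>UNIV. H j l * P j l)"
    and QH: "fderiv \<xi> x (?v j) \<bullet> fderiv2 G x (?v j) w = (\<Sum>l\<in>UNIV. H j l * Q j l)"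
    and PH': "fderiv \<xi> x (dV j w) \<bullet> ?e j = (\<Sum>l\<in>UNIV. H j l * P j l)" for j
    using hsym[OF S(2), of "dV j w" "?v j"] by (simp_all add: shape P_def Q_def)
  let ?PH = "\<Sum>j\<in>UNIV. \<Sum>l\<in>UNIV. H j l * P j l" and ?QH = "\<Sum>j\<in>UNIV. \<Sum>l\<in>UNIV. H j l * Q j l"
  have swap: "(\<Sum>j\<in>UNIV. \<Sum>l\<in>UNIV. H j l * R l j) = (\<Sum>j\<in>UNIV. \<Sum>l\<in>UNIV. H j l * R j l)" for R
    by (subst sum.swap) (simp add: Hsym)
  \<comment> \<open>The symmetric \<open>H\<close> contracted with the antisymmetric
    \<open>P\<close> + \<open>Q\<close> gives 0. This trades the uncontrolled derivatives of the
    fields \<open>v j\<close> for \<open>Q\<close>.\<close>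
  have "0 = (\<Sum>j\<in>UNIV. \<Sum>l\<in>UNIV. H j l * (P j l + P l j + Q j l + Q l j))"
    by (simp add: PQ)
  also have "\<dots> = ?PH + ?PH + ?QH + ?QH"
    using swap[of P] swap[of Q] by (simp add: distrib_left sum.distrib)
  finally have PQH: "?PH = - ?QH" by simp
  have "(\<Sum>j\<in>UNIV. fderiv2 \<xi> x (?v j) w \<bullet> ?e j) + ?QH + ?PH + ?PH = fderiv \<xi> x w \<bullet> W"
    using dtrace by (simp add: inner_add_left inner_add_right sum.distrib PH QH PH' flip: sum_distrib_left)
  then have div_A: "(\<Sum>j\<in>UNIV. fderiv2 \<xi> x (?v j) w \<bullet> ?e j) = fderiv \<xi> x w \<bullet> W + ?QH"
    using PQH by simp
  \<comment> \<open>Codazzi replaces the tangential contribution by the differentiated trace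
    \<open>div_A\<close> plus two corrections. Inserting the equation for \<open>b\<close> cancels
    both \<open>?QH\<close> and the terms with \<open>W\<close>; the remainder is exactly the
    first-order term of the drift Laplacian.\<close>
  have tangential: "(\<Sum>j\<in>UNIV. fderiv2 \<xi> x (?v j) (?v j) \<bullet> fderiv G x w) = fderiv \<xi> x b \<bullet> W"
  proof -
    have "(\<Sum>j\<in>UNIV. fderiv2 \<xi> x (?v j) (?v j) \<bullet> fderiv G x w) =
        (\<Sum>j\<in>UNIV. fderiv2 \<xi> x (?v j) w \<bullet> ?e j + fderiv \<xi> x w \<bullet> fderiv2 G x (?v j) (?v j)
          - fderiv \<xi> x (?v j) \<bullet> fderiv2 G x (?v j) w)"
    proof (rule sum.cong)
      show "fderiv2 \<xi> x (?v j) (?v j) \<bullet> fderiv G x w =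
          fderiv2 \<xi> x (?v j) w \<bullet> ?e j + fderiv \<xi> x w \<bullet> fderiv2 G x (?v j) (?v j)
          - fderiv \<xi> x (?v j) \<bullet> fderiv2 G x (?v j) w" for j
        using codazzi[of "?v j" "?v j" w] symG[OF S(2), of w "?v j"] symxi[OF S(2), of w "?v j"]
        by simp
    qed simp
    also have "\<dots> = (\<Sum>j\<in>UNIV. fderiv2 \<xi> x (?v j) w \<bullet> ?e j) +
        fderiv \<xi> x w \<bullet> (\<Sum>j\<in>UNIV. fderiv2 G x (?v j) (?v j)) - ?QH"
      by (simp add: sum.distrib sum_subtractf QH inner_sum_right)
    also have "\<dots> = fderiv \<xi> x w \<bullet> fderiv G x b"
      by (simp add: div_A b inner_diff_right)
    also have "\<dots> = fderiv \<xi> x b \<bullet> (W - (\<xi> x \<bullet> W) *\<^sub>R \<xi> x)"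
      by (simp add: w hsym[OF S(2)])
    also have "\<dots> = fderiv \<xi> x b \<bullet> W"
      by (simp add: inner_diff_right xi_dxi[OF S(2)])
    finally show ?thesis .
  qed
  \<comment> \<open>The relation D\<xi>(a) \<bullet> \<xi> = 0, which comes from |\<xi>| = 1, is
    differentiated once more; this produces the term -|A|^2.\<close>
  have normal_part: "fderiv2 \<xi> x (?v j) (?v j) \<bullet> \<xi> x = - (norm (fderiv \<xi> x (?v j)))\<^sup>2" for j
    using derivative_of_constant[OF S has_derivative_inner[OF d2xi[OF S(2), of "?v j"] dxi[OF S(2)]],
        of 0 "?v j"] xi_dxi by (simp add: power2_norm_eq_inner)
  have W_eq: "W = (\<xi> x \<bullet> W) *\<^sub>R \<xi> x + fderiv G x w" using w by (simp add: algebra_simps)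
  have "(\<Sum>j\<in>UNIV. fderiv2 \<xi> x (?v j) (?v j) \<bullet> W) =
      (\<Sum>j\<in>UNIV. (\<xi> x \<bullet> W) * (fderiv2 \<xi> x (?v j) (?v j) \<bullet> \<xi> x) +
        fderiv2 \<xi> x (?v j) (?v j) \<bullet> fderiv G x w)"
    by (intro sum.cong refl, subst W_eq) (simp only: inner_add_right inner_scaleR_right)
  then show ?thesis
    by (simp add: sum.distrib sum_subtractf tangential normal_part sum_negf sum_distrib_left)
qed

text \<open>At a minimum of \<open>u + \<epsilon> * |G|\<^sup>2\<close> the two identities \<open>L u = - u * |A|\<^sup>2\<close> and
  \<open>L |G|\<^sup>2 = 2 * n - 2 * (G \<bullet> W)\<close> compete.\<close>

lemma mean_curvature_at_minimum:
  fixes G \<xi> :: "'a::euclidean_space \<Rightarrow> 'b::euclidean_space" and v :: "'i::finite \<Rightarrow> 'a \<Rightarrow> 'a"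
    and \<epsilon> :: real
  assumes S: "open S" "x \<in> S" and CG: "Ck_on 2 S G" and Cxi: "Ck_on 2 S \<xi>"
    and dv: "\<And>j. v j differentiable (at x)"
    and orth: "\<And>y i j. y \<in> S \<Longrightarrow> fderiv G y (v i y) \<bullet> fderiv G y (v j y) = (if i = j then 1 else 0)"
    and span: "range (fderiv G x) \<subseteq> span (range (\<lambda>j. fderiv G x (v j x)))"
    and normal: "\<And>y w. y \<in> S \<Longrightarrow> \<xi> y \<bullet> fderiv G y w = 0"
    and unit: "\<And>y. y \<in> S \<Longrightarrow> \<xi> y \<bullet> \<xi> y = 1"
    and parallel: "\<And>w. fderiv \<xi> x w \<in> range (fderiv G x)"
    and W: "W - (\<xi> x \<bullet> W) *\<^sub>R \<xi> x \<in> range (fderiv G x)"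
    and soliton: "\<And>y. y \<in> S \<Longrightarrow> \<exists>b. (\<Sum>j\<in>UNIV. fderiv2 G y (v j y) (v j y)) = fderiv G y b - W"
    and min: "\<And>y. y \<in> S \<Longrightarrow> \<xi> x \<bullet> W + \<epsilon> * (G x \<bullet> G x) \<le> \<xi> y \<bullet> W + \<epsilon> * (G y \<bullet> G y)"
    and "norm W = 1" "\<epsilon> \<ge> 0" "\<xi> x \<bullet> W \<ge> 0"
  shows "(\<xi> x \<bullet> W) ^ 3 \<le> 2 * CARD('i) * \<epsilon> * (CARD('i) + norm (G x))"
proof -
  let ?v = "\<lambda>j. v j x" and ?u = "\<xi> x \<bullet> W" and ?n = "real CARD('i)"
  let ?A2 = "\<Sum>j\<in>UNIV. (norm (fderiv \<xi> x (?v j)))\<^sup>2"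
  define f where "f y = \<xi> y \<bullet> W + \<epsilon> *\<^sub>R (G y \<bullet> G y)" for y
  obtain b where b: "(\<Sum>j\<in>UNIV. fderiv2 G x (?v j) (?v j)) = fderiv G x b - W"
    using soliton[OF S(2)] by blast
  have Cf: "Ck_on 2 S f"
    unfolding f_def
    by (intro Ck_on_add Ck_on_inner Ck_on_scaleR S CG Cxi) auto
  have df: "fderiv f y = (\<lambda>a. fderiv \<xi> y a \<bullet> W + 2 * \<epsilon> * (G y \<bullet> fderiv G y a))" if "y \<in> S" for y
  proof (rule frechet_derivative_at[symmetric])
    note D = Ck_on_2_has_derivative(1)[OF CG that] Ck_on_2_has_derivative(1)[OF Cxi that]
    show "(f has_derivative (\<lambda>a. fderiv \<xi> y a \<bullet> W + 2 * \<epsilon> * (G y \<bullet> fderiv G y a))) (at y)"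
      unfolding f_def
      by (rule has_derivative_eq_rhs, (rule has_derivative_add has_derivative_scaleR_right
            has_derivative_inner_left has_derivative_inner D)+) (auto simp: inner_commute)
  qed
  have d2f: "fderiv2 f x a a = fderiv2 \<xi> x a a \<bullet> W +
      2 * \<epsilon> * (G x \<bullet> fderiv2 G x a a + fderiv G x a \<bullet> fderiv G x a)" for a
  proof -
    note D = Ck_on_2_has_derivative[OF CG S(2)] Ck_on_2_has_derivative(2)[OF Cxi S(2)]
    have "((\<lambda>y. fderiv \<xi> y a \<bullet> W + (2 * \<epsilon>) *\<^sub>R (G y \<bullet> fderiv G y a)) has_derivative
        (\<lambda>c. fderiv2 \<xi> x a c \<bullet> W + (2 * \<epsilon>) *\<^sub>R (G x \<bullet> fderiv2 G x a c + fderiv G x c \<bullet> fderiv G x a))) (at x)"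
      by (intro has_derivative_add has_derivative_scaleR_right
            has_derivative_inner_left has_derivative_inner D)
    then have "((\<lambda>y. fderiv f y a) has_derivative
        (\<lambda>c. fderiv2 \<xi> x a c \<bullet> W + (2 * \<epsilon>) *\<^sub>R (G x \<bullet> fderiv2 G x a c + fderiv G x c \<bullet> fderiv G x a))) (at x)"
      by (rule has_derivative_transform_within_open[OF _ S]) (simp add: df)
    from fun_cong[OF frechet_derivative_at[OF this], of a] show ?thesis by simp
  qed
  have f_min: "f x \<le> f y" if "y \<in> S" for y using min[OF that] by (simp add: f_def)
  have "0 \<le> (\<Sum>j\<in>UNIV. fderiv2 f x (?v j) (?v j))"
    by (intro sum_nonneg second_derivative_test(2)[OF S(1) Cf S(2) f_min])
  also have "\<dots> = (\<Sum>j\<in>UNIV. fderiv2 \<xi> x (?v j) (?v j) \<bullet> W) +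
      2 * \<epsilon> * (G x \<bullet> (fderiv G x b - W) + ?n)"
    by (simp add: d2f sum.distrib orth[OF S(2)] flip: sum_distrib_left inner_sum_right b)
  \<comment> \<open>The bracket is \<open>fderiv f x b\<close>, which vanishes at the minimum, so
    the unknown vector \<open>b\<close> drops out.\<close>
  also have "\<dots> = (fderiv \<xi> x b \<bullet> W + 2 * \<epsilon> * (G x \<bullet> fderiv G x b)) - ?u * ?A2 + 2 * \<epsilon> * (?n - G x \<bullet> W)"
    using drift_laplacian_mean_curvature[OF S CG Cxi dv orth span normal unit parallel W soliton b]
    by (simp add: algebra_simps)
  also have "fderiv \<xi> x b \<bullet> W + 2 * \<epsilon> * (G x \<bullet> fderiv G x b) = 0"
    using second_derivative_test(1)[OF S(1) Cf S(2) f_min, of b] by (simp add: df[OF S(2)])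
  finally have 1: "?u * ?A2 \<le> 2 * \<epsilon> * (?n - G x \<bullet> W)" by simp
  have "- (G x \<bullet> W) \<le> norm (G x)"
    using Cauchy_Schwarz_ineq2[of "G x" W] \<open>norm W = 1\<close> by simp
  then have 2: "?u * ?A2 \<le> 2 * \<epsilon> * (?n + norm (G x))"
    using 1 \<open>\<epsilon> \<ge> 0\<close> mult_left_mono[of "?n - G x \<bullet> W" "?n + norm (G x)" "2 * \<epsilon>"] by simp
  \<comment> \<open>Cauchy-Schwarz twice: for the sum of the n diagonal entries, then for each entry
    against a unit frame vector. The outcome is u^2 \<le> n * |A|^2.\<close>
  have "?u\<^sup>2 = (\<Sum>j\<in>UNIV. fderiv \<xi> x (?v j) \<bullet> fderiv G x (?v j))\<^sup>2"
    by (simp add: trace_shape_operator[OF S(1) CG Cxi normal soliton S(2)])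
  also have "\<dots> \<le> ?n * (\<Sum>j\<in>UNIV. (fderiv \<xi> x (?v j) \<bullet> fderiv G x (?v j))\<^sup>2)"
    using sum_squared_le_sum_of_squares[of "\<lambda>j. fderiv \<xi> x (?v j) \<bullet> fderiv G x (?v j)" UNIV]
    by (simp add: mult.commute)
  also have "\<dots> \<le> ?n * ?A2"
  proof (intro mult_left_mono sum_mono)
    show "(fderiv \<xi> x (?v j) \<bullet> fderiv G x (?v j))\<^sup>2 \<le> (norm (fderiv \<xi> x (?v j)))\<^sup>2" for j
      using Cauchy_Schwarz_ineq[of "fderiv \<xi> x (?v j)" "fderiv G x (?v j)"] orth[OF S(2), of j j]
      by (simp add: power2_norm_eq_inner)
  qed simp
  finally have "?u * ?u\<^sup>2 \<le> ?u * (?n * ?A2)"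
    using \<open>?u \<ge> 0\<close> by (rule mult_left_mono)
  also have "\<dots> \<le> ?n * (2 * \<epsilon> * (?n + norm (G x)))"
    using 2 mult_left_mono[OF 2, of ?n] by (simp add: mult_ac)
  finally show ?thesis by (simp add: power3_eq_cube power2_eq_square mult_ac)
qed

section \<open>Immersed manifolds in charts\<close>

lemma orthonormal_family_spans:
  fixes e :: "'i::finite \<Rightarrow> 'a::euclidean_space"
  assumes "orthonormal_family e" "range e \<subseteq> S" "dim S = CARD('i)"
  shows "S \<subseteq> span (range e)"
proof (rule card_ge_dim_independent[OF assms(2)])
  have o: "e i \<bullet> e j = (if i = j then 1 else 0)" for i j
    using assms(1) by (simp add: orthonormal_family_def)
  have "inj e" by (rule injI) (metis o zero_neq_one)
  then show "dim S \<le> card (range e)" using assms(3) by (simp add: card_image)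
  show "independent (range e)"
  proof (rule pairwise_orthogonal_independent)
    show "pairwise orthogonal (range e)"
      by (auto simp: pairwise_def orthogonal_def o)
    show "0 \<notin> range e" using o by (metis imageE inner_zero_left zero_neq_one)
  qed
qed

lemma orthonormal_family_exists:
  fixes S :: "'a::euclidean_space set"
  assumes "subspace S" "dim S = CARD('i)"
  obtains e :: "'i::finite \<Rightarrow> 'a" where "orthonormal_family e" "range e \<subseteq> S"
proof -
  obtain B where B: "B \<subseteq> S" "pairwise orthogonal B" "\<And>x. x \<in> B \<Longrightarrow> norm x = 1"
    "independent B" "card B = dim S"
    using orthonormal_basis_subspace[OF assms(1)] by metis
  obtain e :: "'i \<Rightarrow> 'a" where e: "bij_betw e UNIV B"
    using finite_same_card_bij[of "UNIV :: 'i set" B] B(4,5) assms(2) finiteI_independent by auto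
  have "e i \<bullet> e j = (if i = j then 1 else 0)" for i j
  proof -
    have "e i \<in> B" "e j \<in> B" "e i = e j \<longleftrightarrow> i = j"
      using e by (auto simp: bij_betw_def inj_on_def)
    then show ?thesis using B(2) B(3)[of "e i"]
      by (auto simp: pairwise_def orthogonal_def dot_square_norm)
  qed
  then show ?thesis using that[of e] e B(1) by (auto simp: orthonormal_family_def bij_betw_def)
qed

lemma dim_orthogonal_comp:
  fixes S :: "'a::euclidean_space set"
  assumes "subspace S"
  shows "dim (S\<^sup>\<bottom>) + dim S = DIM('a)"
  using dim_subspace_orthogonal_to_vectors[OF assms subspace_UNIV]
  by (simp add: orthogonal_comp_def)

abbreviation chart_deriv ::
  "('m, 'n::finite) chart \<Rightarrow> ('m \<Rightarrow> 'b::real_normed_vector) \<Rightarrow> 'm \<Rightarrow> real ^ 'n \<Rightarrow> 'b" where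
  "chart_deriv c f p \<equiv> fderiv (in_chart c f) (snd c p)"

locale immersed_manifold =
  fixes T :: "'m topology"
    and \<A> :: "('m, 'n::finite) chart set"
    and F :: "'m \<Rightarrow> real ^ ('n + 'k::finite)"
  assumes manifold: "smooth_manifold T \<A>" and immersion: "immersion T \<A> F"
begin

lemma chart_on: "c \<in> \<A> \<Longrightarrow> chart_on T c"
  using manifold by (simp add: smooth_manifold_def)

lemma chart_domain: "c \<in> \<A> \<Longrightarrow> openin T (fst c)"
  using chart_on[of c] by (auto simp: chart_on_def)

lemma chart_inj:
  assumes "c \<in> \<A>"
  shows "inj_on (snd c) (fst c)"
proof -
  have "homeomorphic_map (subtopology T (fst c)) (subtopology euclidean (snd c ` fst c)) (snd c)"
    using chart_on[OF assms] by (auto simp: chart_on_def)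
  then have "inj_on (snd c) (topspace (subtopology T (fst c)))"
    by (rule homeomorphic_imp_injective_map)
  then show ?thesis
    using openin_subset[OF chart_domain[OF assms]] by (simp only: topspace_subtopology_subset)
qed

lemma in_chart_apply: "c \<in> \<A> \<Longrightarrow> q \<in> fst c \<Longrightarrow> in_chart c f (snd c q) = f q"
  using inv_into_f_f[OF chart_inj] by (simp add: in_chart_def split_beta)

lemma chart_image_open:
  assumes "c \<in> \<A>" "openin T V" "V \<subseteq> fst c"
  shows "open (snd c ` V)"
proof -
  have h: "homeomorphic_map (subtopology T (fst c)) (subtopology euclidean (snd c ` fst c)) (snd c)"
    and o: "open (snd c ` fst c)"
    using chart_on[OF assms(1)] by (auto simp: chart_on_def)
  have "openin (subtopology T (fst c)) V"
    using assms chart_domain by (simp add: openin_open_subtopology)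
  then have "openin (subtopology euclidean (snd c ` fst c)) (snd c ` V)"
    using homeomorphic_imp_open_map[OF h] by (simp add: open_map_def)
  then show ?thesis using o openin_open_trans by blast
qed

lemma chart_preimage_open:
  assumes "c \<in> \<A>" "open O'"
  shows "openin T {q \<in> fst c. snd c q \<in> O'}"
proof -
  have h: "homeomorphic_map (subtopology T (fst c)) (subtopology euclidean (snd c ` fst c)) (snd c)"
    using chart_on[OF assms(1)] by (auto simp: chart_on_def)
  have "continuous_map (subtopology T (fst c)) euclidean (snd c)"
    using homeomorphic_imp_continuous_map[OF h] continuous_map_in_subtopology by blast
  from openin_continuous_map_preimage[OF this, of O'] assms
  have "openin (subtopology T (fst c)) {q \<in> topspace (subtopology T (fst c)). snd c q \<in> O'}"
    by simp
  then show ?thesis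
    using chart_domain[OF assms(1)] openin_subset[OF chart_domain[OF assms(1)]]
    by (simp only: topspace_subtopology_subset openin_open_subtopology)
qed

lemma chart_preimage_image:
  "O' \<subseteq> snd c ` fst c \<Longrightarrow> snd c ` {q \<in> fst c. snd c q \<in> O'} = O'"
  by auto

lemma chart_at:
  assumes "p \<in> topspace T"
  shows "chart_at \<A> p \<in> \<A>" "p \<in> fst (chart_at \<A> p)"
proof -
  have "p \<in> (\<Union>c\<in>\<A>. fst c)" using assms manifold by (simp only: smooth_manifold_def)
  then have "\<exists>c. c \<in> \<A> \<and> p \<in> fst c" by blast
  from someI_ex[OF this] show "chart_at \<A> p \<in> \<A>" "p \<in> fst (chart_at \<A> p)"
    by (auto simp: chart_at_def)
qed

lemma transition_smooth:
  "c \<in> \<A> \<Longrightarrow> d \<in> \<A> \<Longrightarrow> smooth_on (snd c ` (fst c \<inter> fst d)) (in_chart c (snd d))"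
  using manifold by (simp add: smooth_manifold_def)

lemma overlap_open: "c \<in> \<A> \<Longrightarrow> d \<in> \<A> \<Longrightarrow> openin T V \<Longrightarrow> open (snd c ` (fst c \<inter> fst d \<inter> V))"
  by (intro chart_image_open openin_Int chart_domain) auto

text \<open>Any other chart differs from \<open>c\<close> by a smooth transition map, so a single
  chart containing \<open>V\<close> decides smoothness.\<close>

lemma manifold_smooth_onI:
  assumes "c \<in> \<A>" "openin T V" "V \<subseteq> fst c" "smooth_on (snd c ` V) (in_chart c f)"
  shows "manifold_smooth_on \<A> V f"
  unfolding manifold_smooth_on_def
proof
  fix d assume d: "d \<in> \<A>"
  have eq: "fst d \<inter> fst c \<inter> V = fst d \<inter> V" using assms(3) by auto
  have o: "open (snd d ` (fst d \<inter> V))" using overlap_open[OF d assms(1,2)] unfolding eq .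
  show "smooth_on (snd d ` (fst d \<inter> V)) (in_chart d f)"
  proof (rule smooth_on_cong[OF o])
    show "smooth_on (snd d ` (fst d \<inter> V)) (\<lambda>y. in_chart c f (in_chart d (snd c) y))"
    proof (rule smooth_on_compose[OF o assms(4)])
      show "smooth_on (snd d ` (fst d \<inter> V)) (in_chart d (snd c))"
        by (rule smooth_on_subset[OF transition_smooth[OF d assms(1)]]) (use assms(3) in auto)
      show "in_chart d (snd c) ` snd d ` (fst d \<inter> V) \<subseteq> snd c ` V"
        using in_chart_apply[OF d] by auto
    qed
    show "in_chart c f (in_chart d (snd c) y) = in_chart d f y" if "y \<in> snd d ` (fst d \<inter> V)" for y
      using that assms(3) by (auto simp: in_chart_apply[OF d] in_chart_apply[OF assms(1)] subset_eq)
  qed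
qed

lemma manifold_smooth_onD:
  "manifold_smooth_on \<A> V f \<Longrightarrow> c \<in> \<A> \<Longrightarrow> V \<subseteq> fst c \<Longrightarrow> smooth_on (snd c ` V) (in_chart c f)"
  unfolding manifold_smooth_on_def by (metis inf.absorb_iff2)

lemma immersion_smooth:
  assumes "c \<in> \<A>"
  shows "smooth_on (snd c ` fst c) (in_chart c F)"
proof -
  have "fst c \<inter> topspace T = fst c" using openin_subset[OF chart_domain[OF assms]] by auto
  then show ?thesis
    using immersion assms unfolding immersion_def manifold_smooth_on_def by metis
qed

text \<open>\<open>differential\<close> is computed in a chart selected separately for each point,
  so it cannot be differentiated again as a function of the point. The chain rule through the
  transition map moves everything into one fixed chart \<open>c\<close>.\<close>

lemma differential_chart:
  assumes c: "c \<in> \<A>" and p: "p \<in> fst c" and f: "in_chart c f differentiable (at (snd c p))"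
  shows "differential \<A> f p =
    chart_deriv c f p \<circ> chart_deriv (chart_at \<A> p) (snd c) p"
proof -
  let ?d = "chart_at \<A> p"
  have pT: "p \<in> topspace T" using p openin_subset[OF chart_domain[OF c]] by auto
  note d = chart_at[OF pT]
  let ?S = "snd ?d ` (fst ?d \<inter> fst c)"
  have o: "open ?S" using overlap_open[OF d(1) c openin_topspace]
      openin_subset[OF chart_domain[OF c]] by (metis Int_assoc inf.absorb1)
  have x: "snd ?d p \<in> ?S" using d p by auto
  have y: "in_chart ?d (snd c) (snd ?d p) = snd c p" by (rule in_chart_apply[OF d])
  have "(in_chart ?d (snd c) has_derivative chart_deriv ?d (snd c) p) (at (snd ?d p))"
    by (rule smooth_on_has_derivative[OF transition_smooth[OF d(1) c] x])
  from diff_chain_at[OF this, of "in_chart c f" "chart_deriv c f p"] f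
  have "((in_chart c f \<circ> in_chart ?d (snd c)) has_derivative
      chart_deriv c f p \<circ> chart_deriv ?d (snd c) p) (at (snd ?d p))"
    by (simp add: y frechet_derivative_works)
  then have "(in_chart ?d f has_derivative
      chart_deriv c f p \<circ> chart_deriv ?d (snd c) p) (at (snd ?d p))"
    by (rule has_derivative_transform_within_open[OF _ o x])
      (auto simp: in_chart_apply[OF d(1)] in_chart_apply[OF c])
  from frechet_derivative_at[OF this] show ?thesis by (simp add: differential_def)
qed

context
  fixes c p
  assumes c: "c \<in> \<A>" and p: "p \<in> fst c"
begin

lemma chart_point: "p \<in> topspace T"
  using p openin_subset[OF chart_domain[OF c]] by auto

lemma chart_deriv_immersion: "(in_chart c F has_derivative chart_deriv c F p) (at (snd c p))"
  using smooth_on_has_derivative[OF immersion_smooth[OF c]] p by simp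

text \<open>Injectivity of the differential of the immersion is inherited by the inner factor of the
  chain rule; an injective linear endomorphism of \<open>real ^ 'n\<close> is surjective.\<close>

lemma transition_surj: "surj (chart_deriv (chart_at \<A> p) (snd c) p)"
proof -
  let ?d = "chart_at \<A> p"
  note d = chart_at[OF chart_point]
  have "inj (differential \<A> F p)" using immersion chart_point by (simp add: immersion_def)
  moreover have "differential \<A> F p = chart_deriv c F p \<circ> chart_deriv ?d (snd c) p"
    using chart_deriv_immersion by (intro differential_chart[OF c p]) (auto simp: differentiable_def)
  ultimately have "inj (chart_deriv ?d (snd c) p)" by (metis inj_on_imageI2)
  moreover have "linear (chart_deriv ?d (snd c) p)"
    using smooth_on_has_derivative[OF transition_smooth[OF d(1) c], of "snd ?d p"] d p
    by (intro has_derivative_linear) auto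
  ultimately show ?thesis by (simp add: linear_injective_imp_surjective)
qed

lemma tangent_space_chart: "tangent_space \<A> F p = range (chart_deriv c F p)"
proof -
  have "differential \<A> F p = chart_deriv c F p \<circ> chart_deriv (chart_at \<A> p) (snd c) p"
    using chart_deriv_immersion by (intro differential_chart[OF c p]) (auto simp: differentiable_def)
  then show ?thesis using transition_surj
    by (simp only: tangent_space_def image_comp[symmetric])
qed

lemma chart_deriv_linear: "linear (chart_deriv c F p)"
  using chart_deriv_immersion by (rule has_derivative_linear)

lemma chart_deriv_inj: "inj (chart_deriv c F p)"
proof -
  let ?t = "chart_deriv (chart_at \<A> p) (snd c) p"
  have i: "inj (chart_deriv c F p \<circ> ?t)"
    using immersion chart_point chart_deriv_immersion
    by (subst differential_chart[OF c p, symmetric]) (auto simp: differentiable_def immersion_def)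
  show ?thesis
  proof (rule injI)
    fix a b assume ab: "chart_deriv c F p a = chart_deriv c F p b"
    obtain a' b' where "a = ?t a'" "b = ?t b'" using transition_surj by (metis surjD)
    then show "a = b" using injD[OF i, of a' b'] ab by simp
  qed
qed

lemma dir_deriv_chart:
  assumes "in_chart c f differentiable (at (snd c p))"
  shows "dir_deriv \<A> F (chart_deriv c F p v) f p = chart_deriv c f p v"
proof -
  let ?t = "chart_deriv (chart_at \<A> p) (snd c) p"
  obtain v' where v: "v = ?t v'" using transition_surj by (metis surjD)
  have F: "differential \<A> F p = chart_deriv c F p \<circ> ?t"
    using chart_deriv_immersion by (intro differential_chart[OF c p]) (auto simp: differentiable_def)
  have "inj (differential \<A> F p)" using immersion chart_point by (simp add: immersion_def)
  from inv_f_f[OF this, of v'] have "inv (differential \<A> F p) (chart_deriv c F p v) = v'"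
    by (simp add: F v)
  then show ?thesis
    by (simp add: dir_deriv_def differential_chart[OF c p assms] v)
qed

end

section \<open>Splitting into tangent and normal spaces\<close>

lemma tangent_subspace: "p \<in> topspace T \<Longrightarrow> subspace (tangent_space \<A> F p)"
  using tangent_space_chart[OF chart_at]
    linear_subspace_image[OF chart_deriv_linear[OF chart_at] subspace_UNIV] by simp

lemma dim_tangent:
  assumes "p \<in> topspace T"
  shows "dim (tangent_space \<A> F p) = CARD('n)"
proof -
  note c = chart_at[OF assms]
  have "dim (range (chart_deriv (chart_at \<A> p) F p)) = dim (UNIV :: (real ^ 'n) set)"
    using chart_deriv_linear[OF c] chart_deriv_inj[OF c] by (intro dim_image_eq) auto
  then show ?thesis using tangent_space_chart[OF c] by simp
qed

lemma dim_normal: "p \<in> topspace T \<Longrightarrow> dim (normal_space \<A> F p) = CARD('k)"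
  using dim_orthogonal_comp[OF tangent_subspace] dim_tangent
  by (simp add: normal_space_def)

lemma normal_subspace: "subspace (normal_space \<A> F p)"
  by (simp add: normal_space_def subspace_orthogonal_comp)

lemma normal_tangent_inner:
  "w \<in> normal_space \<A> F p \<Longrightarrow> t \<in> tangent_space \<A> F p \<Longrightarrow> w \<bullet> t = 0"
  by (auto simp: normal_space_def orthogonal_comp_def orthogonal_def inner_commute)

lemma normal_partI:
  assumes "p \<in> topspace T" "w \<in> normal_space \<A> F p" "v - w \<in> tangent_space \<A> F p"
  shows "normal_part \<A> F p v = w"
  unfolding normal_part_def
proof (rule the_equality)
  fix w' assume w': "w' \<in> normal_space \<A> F p \<and> v - w' \<in> tangent_space \<A> F p"
  have "w - w' \<in> normal_space \<A> F p"
    using assms(2) w' normal_subspace subspace_diff by blast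
  moreover have "w - w' \<in> tangent_space \<A> F p"
    using subspace_diff[OF tangent_subspace[OF assms(1)], of "v - w'" "v - w"] assms(3) w' by simp
  ultimately have "(w - w') \<bullet> (w - w') = 0" by (rule normal_tangent_inner)
  then show "w' = w" by simp
qed (use assms in simp)

lemma normal_part:
  assumes "p \<in> topspace T"
  shows "normal_part \<A> F p v \<in> normal_space \<A> F p" "v - normal_part \<A> F p v \<in> tangent_space \<A> F p"
proof -
  have "v \<in> tangent_space \<A> F p + (tangent_space \<A> F p)\<^sup>\<bottom>"
    using subspace_sum_orthogonal_comp[OF tangent_subspace[OF assms]] by simp
  then obtain t w where tw: "v = t + w" "t \<in> tangent_space \<A> F p" "w \<in> normal_space \<A> F p"
    by (auto simp: set_plus_def normal_space_def)
  then have "normal_part \<A> F p v = w" by (intro normal_partI assms) auto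
  then show "normal_part \<A> F p v \<in> normal_space \<A> F p" "v - normal_part \<A> F p v \<in> tangent_space \<A> F p"
    using tw by auto
qed

lemma normal_part_inner_normal:
  assumes "p \<in> topspace T" "w \<in> normal_space \<A> F p"
  shows "v \<bullet> w = normal_part \<A> F p v \<bullet> w"
  using normal_tangent_inner[OF assms(2) normal_part(2)[OF assms(1), of v]]
  by (simp add: inner_diff_right inner_commute)

text \<open>With a smooth tangent frame this formula shows that the normal projection of a fixed
  vector varies smoothly, which is applied to \<open>W\<close> and to the start vectors of normal
  frames.\<close>

lemma normal_part_tangent_frame:
  assumes "p \<in> topspace T" "orthonormal_family e" "\<And>j :: 'n. e j \<in> tangent_space \<A> F p"
  shows "normal_part \<A> F p v = v - (\<Sum>j\<in>UNIV. (v \<bullet> e j) *\<^sub>R e j)"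
proof -
  let ?t = "v - normal_part \<A> F p v"
  have "tangent_space \<A> F p \<subseteq> span (range e)"
    using assms by (intro orthonormal_family_spans) (auto simp: dim_tangent)
  then have "(\<Sum>j\<in>UNIV. (?t \<bullet> e j) *\<^sub>R e j) = ?t"
    using normal_part(2)[OF assms(1)] by (intro orthonormal_expansion assms(2)) auto
  moreover have "?t \<bullet> e j = v \<bullet> e j" for j
    using normal_tangent_inner[OF normal_part(1)[OF assms(1)] assms(3)] by (simp add: inner_diff_left)
  ultimately show ?thesis by simp
qed

lemma normal_part_normal_frame:
  assumes "p \<in> topspace T" "orthonormal_family \<nu>" "\<And>\<alpha> :: 'k. \<nu> \<alpha> \<in> normal_space \<A> F p"
  shows "normal_part \<A> F p v = (\<Sum>\<alpha>\<in>UNIV. (v \<bullet> \<nu> \<alpha>) *\<^sub>R \<nu> \<alpha>)"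
proof -
  have "normal_space \<A> F p \<subseteq> span (range \<nu>)"
    using assms by (intro orthonormal_family_spans) (auto simp: dim_normal)
  then have "(\<Sum>\<alpha>\<in>UNIV. (normal_part \<A> F p v \<bullet> \<nu> \<alpha>) *\<^sub>R \<nu> \<alpha>) = normal_part \<A> F p v"
    using normal_part(1)[OF assms(1)] by (intro orthonormal_expansion assms(2)) auto
  then show ?thesis using normal_part_inner_normal[OF assms(1) assms(3)] by simp
qed

end

section \<open>Adapted frames and the soliton equation\<close>

lemma smooth_orthonormal_family:
  fixes E :: "'i::finite \<Rightarrow> 'a::euclidean_space \<Rightarrow> 'b::euclidean_space"
  assumes "open S" "x0 \<in> S" "\<And>i. smooth_on S (E i)"
    and "\<forall>c. (\<Sum>i\<in>UNIV. c i *\<^sub>R E i x0) = 0 \<longrightarrow> (\<forall>i. c i = 0)"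
  obtains U e a where "open U" "x0 \<in> U" "U \<subseteq> S"
    "\<And>i. smooth_on U (e i)" "\<And>i l. smooth_on U (a i l)"
    "\<And>x i. x \<in> U \<Longrightarrow> e i x = (\<Sum>l\<in>UNIV. a i l x *\<^sub>R E l x)"
    "\<And>x. x \<in> U \<Longrightarrow> orthonormal_family (\<lambda>i :: 'i. e i x)"
proof -
  have "\<exists>U e a. open U \<and> x0 \<in> U \<and> U \<subseteq> S \<and>
    (\<forall>i\<in>(UNIV :: 'i set). smooth_on U (e i)) \<and> (\<forall>i\<in>(UNIV :: 'i set). \<forall>l\<in>UNIV. smooth_on U (a i l)) \<and>
    (\<forall>x\<in>U. \<forall>i\<in>(UNIV :: 'i set). e i x = (\<Sum>l\<in>UNIV. a i l x *\<^sub>R E l x)) \<and>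
    (\<forall>x\<in>U. \<forall>i\<in>(UNIV :: 'i set). \<forall>j\<in>UNIV. e i x \<bullet> e j x = (if i = j then 1 else 0))"
    using assms by (intro smooth_gram_schmidt) auto
  then obtain U e a where U: "open U" "x0 \<in> U" "U \<subseteq> S"
    and "\<forall>i\<in>(UNIV :: 'i set). smooth_on U (e i)" "\<forall>i\<in>(UNIV :: 'i set). \<forall>l\<in>UNIV. smooth_on U (a i l)"
      "\<forall>x\<in>U. \<forall>i\<in>(UNIV :: 'i set). e i x = (\<Sum>l\<in>UNIV. a i l x *\<^sub>R E l x)"
      "\<forall>x\<in>U. \<forall>i\<in>(UNIV :: 'i set). \<forall>j\<in>UNIV. e i x \<bullet> e j x = (if i = j then 1 else 0)"
    by (elim exE conjE) (rule that)
  then show ?thesis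
    by (intro that[of U e a]) (auto simp: orthonormal_family_def)
qed

context immersed_manifold
begin

lemma in_chart_comp:
  "c \<in> \<A> \<Longrightarrow> x \<in> snd c ` fst c \<Longrightarrow> in_chart c (\<lambda>q. g (snd c q)) x = g x"
  by (auto simp: in_chart_apply)

text \<open>The images of the coordinate vectors are orthonormalised. The Gram-Schmidt coefficients,
  applied to the coordinate vectors themselves, give the smooth fields \<open>v j\<close> along
  which the local representatives are later differentiated.\<close>

lemma tangent_frame_exists:
  assumes c: "c \<in> \<A>" and p: "p \<in> fst c"
  obtains V v e where "openin T V" "p \<in> V" "V \<subseteq> fst c" "tangent_frame_on T \<A> F V e"
    "\<And>j. smooth_on (snd c ` V) (v j)"
    "\<And>q j. q \<in> V \<Longrightarrow> e j q = chart_deriv c F q (v j (snd c q))"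
proof -
  let ?G = "in_chart c F" and ?\<Omega> = "snd c ` fst c"
  define E where "E i x = fderiv ?G x (axis i 1)" for i :: 'n and x
  have o: "open ?\<Omega>" using chart_image_open[OF c chart_domain[OF c]] by simp
  have lin: "linear (fderiv ?G x)" if "x \<in> ?\<Omega>" for x
    using smooth_on_has_derivative[OF immersion_smooth[OF c] that] by (rule has_derivative_linear)
  have comb: "(\<Sum>i\<in>UNIV. a i *\<^sub>R E i x) = fderiv ?G x (\<Sum>i\<in>UNIV. a i *\<^sub>R axis i 1)"
    if "x \<in> ?\<Omega>" for x a
    by (simp add: E_def linear_sum[OF lin[OF that]] linear_cmul[OF lin[OF that]])
  have sE: "smooth_on ?\<Omega> (E i)" for i
    unfolding E_def by (rule smooth_on_frechet_derivative[OF immersion_smooth[OF c]])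
  have indep: "a j = 0" if z: "(\<Sum>i\<in>UNIV. a i *\<^sub>R E i (snd c p)) = 0" for a j
  proof -
    have "snd c p \<in> ?\<Omega>" using p by simp
    then have "chart_deriv c F p (\<Sum>i\<in>UNIV. a i *\<^sub>R axis i 1) = chart_deriv c F p 0"
      using z comb[of "snd c p" a] linear_0[OF chart_deriv_linear[OF c p]] by simp
    then have "(\<Sum>i\<in>UNIV. a i *\<^sub>R axis i (1 :: real)) = 0"
      by (rule injD[OF chart_deriv_inj[OF c p]])
    then have "(\<Sum>i\<in>UNIV. a i *\<^sub>R axis i (1 :: real)) $ j = 0" by simp
    then show ?thesis
      by (simp add: axis_def if_distrib[of "\<lambda>t. _ * t"] cong: if_cong)
  qed
  have x0: "snd c p \<in> ?\<Omega>" using p by simp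
  have indep: "\<forall>a. (\<Sum>i\<in>UNIV. a i *\<^sub>R E i (snd c p)) = 0 \<longrightarrow> (\<forall>j. a j = 0)"
    using indep by blast
  obtain U e a where U: "open U" "snd c p \<in> U" "U \<subseteq> ?\<Omega>"
    and e: "\<And>i. smooth_on U (e i)" and a: "\<And>i l. smooth_on U (a i l)"
    and ea: "\<And>x i. x \<in> U \<Longrightarrow> e i x = (\<Sum>l\<in>UNIV. a i l x *\<^sub>R E l x)"
    and orth: "\<And>x. x \<in> U \<Longrightarrow> orthonormal_family (\<lambda>i :: 'n. e i x)"
    using smooth_orthonormal_family[where E = E, OF o x0 sE indep] by blast
  define V where "V = {q \<in> fst c. snd c q \<in> U}"
  define v where "v j x = (\<Sum>l\<in>UNIV. a j l x *\<^sub>R axis l (1 :: real))" for j x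
  have V: "openin T V" "p \<in> V" "V \<subseteq> fst c" "snd c ` V = U"
    using chart_preimage_open[OF c U(1)] p U chart_preimage_image[OF U(3)] by (auto simp: V_def)
  have qU: "snd c q \<in> U" "q \<in> fst c" if "q \<in> V" for q using that by (auto simp: V_def)
  have ev: "e j (snd c q) = chart_deriv c F q (v j (snd c q))" if "q \<in> V" for q j
    using qU[OF that] U(3) ea comb by (auto simp: v_def)
  show ?thesis
  proof (rule that[of V "\<lambda>j q. e j (snd c q)" v])
    show "tangent_frame_on T \<A> F V (\<lambda>j q. e j (snd c q))"
      unfolding tangent_frame_on_def
    proof (intro conjI allI ballI)
      show "manifold_smooth_on \<A> V (\<lambda>q. e j (snd c q))" for j
      proof (rule manifold_smooth_onI[OF c V(1,3)])
        show "smooth_on (snd c ` V) (in_chart c (\<lambda>q. e j (snd c q)))"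
          unfolding V(4)
        proof (rule smooth_on_cong[OF U(1)])
          show "smooth_on U (e j)" using e by simp
          show "e j x = in_chart c (\<lambda>q. e j (snd c q)) x" if "x \<in> U" for x
            using that U(3) by (simp add: in_chart_comp[OF c] subset_eq)
        qed
      qed
      show "e j (snd c q) \<in> tangent_space \<A> F q" if "q \<in> V" for q j
        using ev[OF that] tangent_space_chart[OF c] qU[OF that] by auto
      show "orthonormal_family (\<lambda>j. e j (snd c q))" if "q \<in> V" for q
        using orth qU[OF that] by simp
    qed (rule V)
    show "smooth_on (snd c ` V) (v j)" for j
      unfolding V(4) v_def using a by (intro smooth_on_sum smooth_on_scaleR U(1)) auto
  qed (use V ev in auto)
qed

text \<open>An orthonormal basis \<open>b\<close> of the normal space at \<open>p\<close> is kept
  constant and projected to the nearby normal spaces. The projections \<open>N\<close> are smooth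
  and equal \<open>b\<close> at \<open>p\<close>, hence independent there; Gram-Schmidt forms linear
  combinations and so stays normal.\<close>

lemma normal_frame_exists:
  assumes c: "c \<in> \<A>" and V: "V \<subseteq> fst c" "p \<in> V" and fe: "tangent_frame_on T \<A> F V e"
  obtains V' \<nu> where "openin T V'" "p \<in> V'" "V' \<subseteq> V" "normal_frame_on T \<A> F V' \<nu>"
proof -
  let ?\<Omega> = "snd c ` V"
  have oV: "openin T V" and se: "\<And>j. smooth_on ?\<Omega> (in_chart c (e j))"
    and e: "\<And>q. q \<in> V \<Longrightarrow> orthonormal_family (\<lambda>j. e j q)"
      "\<And>q j. q \<in> V \<Longrightarrow> e j q \<in> tangent_space \<A> F q"
    using fe manifold_smooth_onD[OF _ c V(1)] by (auto simp: tangent_frame_on_def)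
  have VT: "q \<in> topspace T" if "q \<in> V" for q using openin_subset[OF oV] that by auto
  have o: "open ?\<Omega>" by (rule chart_image_open[OF c oV V(1)])
  obtain b :: "'k \<Rightarrow> real ^ ('n + 'k)"
    where b: "orthonormal_family b" "range b \<subseteq> normal_space \<A> F p"
    using orthonormal_family_exists[OF normal_subspace dim_normal[OF VT[OF V(2)]]] by blast
  define N where "N \<alpha> x = b \<alpha> - (\<Sum>j\<in>UNIV. (b \<alpha> \<bullet> in_chart c (e j) x) *\<^sub>R in_chart c (e j) x)" for \<alpha> x
  have sN: "smooth_on ?\<Omega> (N \<alpha>)" for \<alpha>
    unfolding N_def by (intro smooth_on_diff smooth_on_sum smooth_on_scaleR smooth_on_inner o se) auto
  have Nq: "N \<alpha> (snd c q) = normal_part \<A> F q (b \<alpha>)" if "q \<in> V" for \<alpha> q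
    using normal_part_tangent_frame[OF VT[OF that] e(1)[OF that] e(2)[OF that], of "b \<alpha>"]
      V(1) that by (auto simp: N_def in_chart_apply[OF c] subset_eq)
  have Np: "N \<alpha> (snd c p) = b \<alpha>" for \<alpha>
    unfolding Nq[OF V(2)] using b(2) subspace_0[OF tangent_subspace[OF VT[OF V(2)]]]
    by (intro normal_partI VT V(2)) auto
  have indep: "a \<beta> = 0" if z: "(\<Sum>\<alpha>\<in>UNIV. a \<alpha> *\<^sub>R N \<alpha> (snd c p)) = 0" for a \<beta>
  proof -
    have "(\<Sum>\<alpha>\<in>UNIV. a \<alpha> *\<^sub>R b \<alpha>) \<bullet> b \<beta> = 0" using z by (simp add: Np)
    then show ?thesis using b(1)
      by (simp add: inner_sum_left orthonormal_family_def if_distrib[of "\<lambda>t. _ * t"] cong: if_cong)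
  qed
  have x0: "snd c p \<in> ?\<Omega>" using V(2) by simp
  have indep: "\<forall>a. (\<Sum>i\<in>UNIV. a i *\<^sub>R N i (snd c p)) = 0 \<longrightarrow> (\<forall>j. a j = 0)"
    using indep by blast
  obtain U \<nu> a where U: "open U" "snd c p \<in> U" "U \<subseteq> ?\<Omega>"
    and \<nu>: "\<And>i. smooth_on U (\<nu> i)" and "\<And>i l. smooth_on U (a i l)"
    and \<nu>a: "\<And>x i. x \<in> U \<Longrightarrow> \<nu> i x = (\<Sum>l\<in>UNIV. a i l x *\<^sub>R N l x)"
    and orth: "\<And>x. x \<in> U \<Longrightarrow> orthonormal_family (\<lambda>i :: 'k. \<nu> i x)"
    using smooth_orthonormal_family[where E = N, OF o x0 sN indep] by blast
  define V' where "V' = {q \<in> fst c. snd c q \<in> U}"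
  have U': "U \<subseteq> snd c ` fst c" using U(3) V(1) by blast
  have V': "openin T V'" "p \<in> V'" "V' \<subseteq> fst c" "snd c ` V' = U"
    using chart_preimage_open[OF c U(1)] V U chart_preimage_image[OF U'] by (auto simp: V'_def)
  have "V' \<subseteq> V"
  proof
    fix q assume "q \<in> V'"
    then obtain q' where "q \<in> fst c" "q' \<in> V" "snd c q = snd c q'" using U(3) by (auto simp: V'_def)
    then show "q \<in> V" using chart_inj[OF c] V(1) by (metis inj_onD subsetD)
  qed
  have qU: "snd c q \<in> U" "q \<in> fst c" "q \<in> V" if "q \<in> V'" for q
    using that \<open>V' \<subseteq> V\<close> by (auto simp: V'_def)
  have "normal_frame_on T \<A> F V' (\<lambda>\<alpha> q. \<nu> \<alpha> (snd c q))"
    unfolding normal_frame_on_def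
  proof (intro conjI allI ballI)
    show "manifold_smooth_on \<A> V' (\<lambda>q. \<nu> j (snd c q))" for j
    proof (rule manifold_smooth_onI[OF c V'(1,3)])
      show "smooth_on (snd c ` V') (in_chart c (\<lambda>q. \<nu> j (snd c q)))"
        unfolding V'(4)
      proof (rule smooth_on_cong[OF U(1)])
        show "smooth_on U (\<nu> j)" using \<nu> by simp
        show "\<nu> j x = in_chart c (\<lambda>q. \<nu> j (snd c q)) x" if "x \<in> U" for x
          using that U' by (simp add: in_chart_comp[OF c] subset_eq)
      qed
    qed
    show "\<nu> j (snd c q) \<in> normal_space \<A> F q" if "q \<in> V'" for q j
      using \<nu>a qU[OF that] Nq normal_part(1)[OF VT]
      by (auto intro!: subspace_sum[OF normal_subspace] subspace_scale[OF normal_subspace])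
    show "orthonormal_family (\<lambda>j. \<nu> j (snd c q))" if "q \<in> V'" for q
      using orth qU[OF that] by simp
  qed (rule V')
  then show ?thesis using that V' \<open>V' \<subseteq> V\<close> by blast
qed

lemma tangent_frame_on_subset:
  assumes "tangent_frame_on T \<A> F V e" "openin T V'" "V' \<subseteq> V"
  shows "tangent_frame_on T \<A> F V' e"
proof -
  have "manifold_smooth_on \<A> V' (e i)" for i
    unfolding manifold_smooth_on_def
  proof
    fix c assume "c \<in> \<A>"
    then have "smooth_on (snd c ` (fst c \<inter> V)) (in_chart c (e i))"
      using assms(1) by (simp add: tangent_frame_on_def manifold_smooth_on_def)
    then show "smooth_on (snd c ` (fst c \<inter> V')) (in_chart c (e i))"
      by (rule smooth_on_subset) (use assms(3) in auto)
  qed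
  then show ?thesis using assms by (auto simp: tangent_frame_on_def)
qed

end

section \<open>Translating solitons\<close>

locale soliton = immersed_manifold T \<A> F
  for T :: "'m topology"
    and \<A> :: "('m, 'n::finite) chart set"
    and F :: "'m \<Rightarrow> real ^ ('n + 'k::finite)" +
  fixes W :: "real ^ ('n + 'k)"
  assumes soliton: "translating_soliton T \<A> F W"
begin

abbreviation WN :: "'m \<Rightarrow> real ^ ('n + 'k)" where "WN p \<equiv> normal_part \<A> F p W"

text \<open>Independence of the frames comes from the soliton condition: every choice yields the sum
  of the (W \<bullet> \<nu>_\<alpha>) \<nu>_\<alpha>, which is the normal part of \<open>W\<close>.
  The existence of frames then supplies the witness for \<open>THE\<close>.\<close>

lemma mean_curv_vec_eq:
  assumes "p \<in> topspace T"
  shows "mean_curv_vec T \<A> F p = - WN p"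
  unfolding mean_curv_vec_def
proof (rule the_equality)
  have frames: "(\<Sum>\<alpha>\<in>UNIV. mean_curv_coeff \<A> F e \<nu> \<alpha> p *\<^sub>R \<nu> \<alpha> p) = WN p"
    if "p \<in> V" "tangent_frame_on T \<A> F V e" "normal_frame_on T \<A> F V \<nu>" for V e \<nu>
  proof -
    have "mean_curv_coeff \<A> F e \<nu> \<alpha> p = W \<bullet> \<nu> \<alpha> p" for \<alpha>
      using soliton that by (simp add: translating_soliton_def inner_commute)
    then show ?thesis
      using normal_part_normal_frame[OF assms, of "\<lambda>\<alpha>. \<nu> \<alpha> p" W] that
      by (simp add: normal_frame_on_def)
  qed
  show "h = - WN p" if "\<exists>V e \<nu>. p \<in> V \<and> tangent_frame_on T \<A> F V e \<and> normal_frame_on T \<A> F V \<nu> \<and>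
      h = - (\<Sum>\<alpha>\<in>UNIV. mean_curv_coeff \<A> F e \<nu> \<alpha> p *\<^sub>R \<nu> \<alpha> p)" for h
    using that by (elim exE conjE) (simp add: frames)
  obtain V e where V: "p \<in> V" "V \<subseteq> fst (chart_at \<A> p)" "tangent_frame_on T \<A> F V e"
    by (rule tangent_frame_exists[OF chart_at[OF assms]]) (rule that)
  obtain V' \<nu> where V': "openin T V'" "p \<in> V'" "V' \<subseteq> V" "normal_frame_on T \<A> F V' \<nu>"
    by (rule normal_frame_exists[OF chart_at(1)[OF assms] V(2,1,3)]) (rule that)
  have e': "tangent_frame_on T \<A> F V' e" by (rule tangent_frame_on_subset[OF V(3) V'(1,3)])
  show "\<exists>V e \<nu>. p \<in> V \<and> tangent_frame_on T \<A> F V e \<and> normal_frame_on T \<A> F V \<nu> \<and>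
      - WN p = - (\<Sum>\<alpha>\<in>UNIV. mean_curv_coeff \<A> F e \<nu> \<alpha> p *\<^sub>R \<nu> \<alpha> p)"
    by (intro exI[of _ V'] exI[of _ e] exI[of _ \<nu>] conjI V' e') (simp add: frames[OF V'(2) e' V'(4)])
qed

lemma principal_normal_eq: "p \<in> topspace T \<Longrightarrow> principal_normal T \<A> F p = sgn (WN p)"
  by (simp add: principal_normal_def mean_curv_vec_eq sgn_div_norm)

text \<open>By Weingarten and the soliton condition, the trace of the second derivatives plus
  \<open>W\<close> is orthogonal to every \<nu>_\<alpha>, hence tangent. Only the existence of
  \<open>b\<close> matters: at the minimum it meets a vanishing derivative.\<close>

lemma soliton_equation:
  assumes c: "c \<in> \<A>" and V: "V \<subseteq> fst c" "q \<in> V" and fe: "tangent_frame_on T \<A> F V e"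
    and ev: "\<And>j. e j q = chart_deriv c F q (v j)"
  shows "\<exists>b. (\<Sum>j\<in>UNIV. fderiv2 (in_chart c F) (snd c q) (v j) (v j)) = chart_deriv c F q b - W"
proof -
  let ?G = "in_chart c F" and ?x = "snd c q"
  let ?B = "\<Sum>j\<in>UNIV. fderiv2 ?G ?x (v j) (v j)"
  obtain V' \<nu> where V': "openin T V'" "q \<in> V'" "V' \<subseteq> V" and fn: "normal_frame_on T \<A> F V' \<nu>"
    by (rule normal_frame_exists[OF c V fe]) (rule that)
  have V'c: "V' \<subseteq> fst c" using V'(3) V(1) by blast
  have qc: "q \<in> fst c" and qT: "q \<in> topspace T" using V V' openin_subset[OF V'(1)] by auto
  have fe': "tangent_frame_on T \<A> F V' e" by (rule tangent_frame_on_subset[OF fe V'(1,3)])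
  let ?S = "snd c ` V'"
  have o: "open ?S" by (rule chart_image_open[OF c V'(1) V'c])
  have x: "?x \<in> ?S" using V' by simp
  have CG: "Ck_on 2 ?S ?G"
    using smooth_on_subset[OF immersion_smooth[OF c], of ?S] V'c unfolding smooth_on_def by blast
  have \<nu>n: "in_chart c (\<nu> \<alpha>) y \<bullet> fderiv ?G y w = 0" if y: "y \<in> ?S" for \<alpha> y w
  proof -
    obtain q' where q': "q' \<in> V'" "y = snd c q'" using y by auto
    then have "q' \<in> fst c" using V'c by auto
    then have "fderiv ?G y w \<in> tangent_space \<A> F q'"
      using tangent_space_chart[OF c] q' by simp
    moreover have "\<nu> \<alpha> q' \<in> normal_space \<A> F q'" using fn q' by (simp add: normal_frame_on_def)
    ultimately have "\<nu> \<alpha> q' \<bullet> fderiv ?G y w = 0" by (metis normal_tangent_inner)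
    then show ?thesis by (simp add: q'(2) in_chart_apply[OF c \<open>q' \<in> fst c\<close>])
  qed
  have "(?B + W) \<bullet> \<nu> \<alpha> q = 0" for \<alpha>
  proof -
    have s\<nu>: "smooth_on ?S (in_chart c (\<nu> \<alpha>))"
      by (rule manifold_smooth_onD[OF _ c V'c]) (use fn in \<open>simp add: normal_frame_on_def\<close>)
    note d\<nu> = smooth_on_has_derivative[OF s\<nu> x]
    have dd: "dir_deriv \<A> F (e j q) (\<nu> \<alpha>) q = chart_deriv c (\<nu> \<alpha>) q (v j)" for j
      unfolding ev by (rule dir_deriv_chart[OF c qc]) (use d\<nu> in \<open>auto simp: differentiable_def\<close>)
    have "\<nu> \<alpha> q \<bullet> W = mean_curv_coeff \<A> F e \<nu> \<alpha> q"
      using soliton fe' fn V'(2) by (simp add: translating_soliton_def)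
    also have "\<dots> = (\<Sum>j\<in>UNIV. chart_deriv c (\<nu> \<alpha>) q (v j) \<bullet> chart_deriv c F q (v j))"
      unfolding mean_curv_coeff_def second_fund_coeff_def by (simp add: dd flip: ev)
    also have "\<dots> = (\<Sum>j\<in>UNIV. - (\<nu> \<alpha> q \<bullet> fderiv2 ?G ?x (v j) (v j)))"
      using shape_operator_inner[OF o CG d\<nu> \<nu>n x]
      by (simp add: in_chart_apply[OF c qc])
    also have "\<dots> = - (\<nu> \<alpha> q \<bullet> ?B)" by (simp add: inner_sum_right sum_negf)
    finally show ?thesis by (simp add: inner_add_right inner_commute[of _ "\<nu> \<alpha> q"])
  qed
  then have "normal_part \<A> F q (?B + W) = 0"
    using normal_part_normal_frame[OF qT, of "\<lambda>\<alpha>. \<nu> \<alpha> q" "?B + W"] fn V'(2)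
    by (simp add: normal_frame_on_def)
  then have "?B + W \<in> range (chart_deriv c F q)"
    using normal_part(2)[OF qT, of "?B + W"] tangent_space_chart[OF c qc] by simp
  then obtain b where "?B + W = chart_deriv c F q b" by auto
  then show ?thesis by (intro exI[of _ b]) (simp add: algebra_simps)
qed

text \<open>Collects around one point the chart data from which the hypotheses of
  \<open>mean_curvature_at_minimum\<close> are verified.\<close>

lemma soliton_local_structure:
  assumes c: "c \<in> \<A>" and p: "p \<in> fst c"
  obtains V v where "openin T V" "p \<in> V" "V \<subseteq> fst c" "\<And>j. smooth_on (snd c ` V) (v j)"
    "\<And>q. q \<in> V \<Longrightarrow> orthonormal_family (\<lambda>j :: 'n. chart_deriv c F q (v j (snd c q)))"
    "\<And>q. q \<in> V \<Longrightarrow> \<exists>b. (\<Sum>j\<in>UNIV. fderiv2 (in_chart c F) (snd c q) (v j (snd c q)) (v j (snd c q))) =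
       chart_deriv c F q b - W"
    "smooth_on (snd c ` V) (in_chart c WN)"
proof -
  obtain V v e where V: "openin T V" "p \<in> V" "V \<subseteq> fst c" and fe: "tangent_frame_on T \<A> F V e"
    and v: "\<And>j. smooth_on (snd c ` V) (v j)"
    and ev: "\<And>q j. q \<in> V \<Longrightarrow> e j q = chart_deriv c F q (v j (snd c q))"
    by (rule tangent_frame_exists[OF c p]) (rule that)
  have e: "orthonormal_family (\<lambda>j. e j q)" "e j q \<in> tangent_space \<A> F q" if "q \<in> V" for q j
    using fe that by (auto simp: tangent_frame_on_def)
  have se: "smooth_on (snd c ` V) (in_chart c (e j))" for j
    using fe manifold_smooth_onD[OF _ c V(3)] by (auto simp: tangent_frame_on_def)
  have o: "open (snd c ` V)" by (rule chart_image_open[OF c V(1,3)])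
  have "smooth_on (snd c ` V) (in_chart c WN)"
  proof (rule smooth_on_cong[OF o])
    show "smooth_on (snd c ` V)
        (\<lambda>x. W - (\<Sum>j\<in>UNIV. (W \<bullet> in_chart c (e j) x) *\<^sub>R in_chart c (e j) x))"
      by (intro smooth_on_diff smooth_on_sum smooth_on_scaleR smooth_on_inner o se) auto
    show "W - (\<Sum>j\<in>UNIV. (W \<bullet> in_chart c (e j) x) *\<^sub>R in_chart c (e j) x) = in_chart c WN x"
      if x: "x \<in> snd c ` V" for x
    proof -
      obtain q where q: "q \<in> V" "x = snd c q" using x by auto
      then have "q \<in> fst c" "q \<in> topspace T" using V openin_subset by auto
      then show ?thesis
        using normal_part_tangent_frame[OF _ e(1)[OF q(1)] e(2)[OF q(1)], of W]
        by (simp add: q(2) in_chart_apply[OF c])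
    qed
  qed
  moreover have "orthonormal_family (\<lambda>j. chart_deriv c F q (v j (snd c q)))" if "q \<in> V" for q
    using e(1)[OF that] ev[OF that] by simp
  moreover have "\<exists>b. (\<Sum>j\<in>UNIV. fderiv2 (in_chart c F) (snd c q) (v j (snd c q)) (v j (snd c q))) =
       chart_deriv c F q b - W" if "q \<in> V" for q
    by (rule soliton_equation[OF c V(3) that fe ev[OF that]])
  ultimately show ?thesis by (intro that[OF V v])
qed

end

section \<open>Continuity, height gradient and principal normal\<close>

context immersed_manifold
begin

lemma continuous_map_local:
  fixes f :: "'m \<Rightarrow> 'c::topological_space"
  assumes "\<And>p. p \<in> topspace T \<Longrightarrow>
    \<exists>c\<in>\<A>. \<exists>V. openin T V \<and> p \<in> V \<and> V \<subseteq> fst c \<and> continuous_on (snd c ` V) (in_chart c f)"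
  shows "continuous_map T euclidean f"
  unfolding continuous_map_def
proof (intro conjI allI impI)
  fix U :: "'c set" assume "openin euclidean U"
  then have U: "open U" by simp
  show "openin T {p \<in> topspace T. f p \<in> U}"
    unfolding openin_subopen[of T "{p \<in> topspace T. f p \<in> U}"]
  proof
    fix p assume p: "p \<in> {p \<in> topspace T. f p \<in> U}"
    then obtain c V where c: "c \<in> \<A>" and V: "openin T V" "p \<in> V" "V \<subseteq> fst c"
      and cont: "continuous_on (snd c ` V) (in_chart c f)"
      using assms by blast
    define O' where "O' = snd c ` V \<inter> in_chart c f -` U"
    have "open O'"
      unfolding O'_def by (rule continuous_open_preimage[OF cont chart_image_open[OF c V(1,3)] U])
    then have "openin T {q \<in> fst c. snd c q \<in> O'}" by (rule chart_preimage_open[OF c])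
    moreover have "p \<in> {q \<in> fst c. snd c q \<in> O'}"
      using p V in_chart_apply[OF c, of p f] by (auto simp: O'_def)
    moreover have "{q \<in> fst c. snd c q \<in> O'} \<subseteq> {p \<in> topspace T. f p \<in> U}"
    proof
      fix q assume "q \<in> {q \<in> fst c. snd c q \<in> O'}"
      then have "q \<in> fst c" "in_chart c f (snd c q) \<in> U" by (auto simp: O'_def)
      then show "q \<in> {p \<in> topspace T. f p \<in> U}"
        using openin_subset[OF chart_domain[OF c]] in_chart_apply[OF c, of q f] by auto
    qed
    ultimately show "\<exists>N. openin T N \<and> p \<in> N \<and> N \<subseteq> {p \<in> topspace T. f p \<in> U}" by blast
  qed
qed auto

lemma continuous_immersion: "continuous_map T euclidean F"
proof (rule continuous_map_local)
  fix p assume "p \<in> topspace T"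
  note c = chart_at[OF this]
  show "\<exists>c\<in>\<A>. \<exists>V. openin T V \<and> p \<in> V \<and> V \<subseteq> fst c \<and> continuous_on (snd c ` V) (in_chart c F)"
    using c chart_domain[OF c(1)] smooth_on_continuous[OF immersion_smooth[OF c(1)]] by blast
qed

end

context soliton
begin

lemma continuous_WN: "continuous_map T euclidean WN"
proof (rule continuous_map_local)
  fix p assume "p \<in> topspace T"
  note c = chart_at[OF this]
  obtain V v where V: "openin T V" "p \<in> V" "V \<subseteq> fst (chart_at \<A> p)"
    "smooth_on (snd (chart_at \<A> p) ` V) (in_chart (chart_at \<A> p) WN)"
    by (rule soliton_local_structure[OF c]) (rule that)
  then show "\<exists>c\<in>\<A>. \<exists>V. openin T V \<and> p \<in> V \<and> V \<subseteq> fst c \<and> continuous_on (snd c ` V) (in_chart c WN)"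
    using c(1) smooth_on_continuous by blast
qed

lemma WN_inner: "p \<in> topspace T \<Longrightarrow> WN p \<bullet> W = (norm (WN p))\<^sup>2"
  using normal_part_inner_normal[OF _ normal_part(1), of p W]
  by (simp add: inner_commute power2_norm_eq_inner)

lemma sgn_WN_inner: "p \<in> topspace T \<Longrightarrow> sgn (WN p) \<bullet> W = norm (WN p)"
  by (cases "WN p = 0") (simp_all add: sgn_div_norm WN_inner power2_eq_square)

lemma norm_tangential_part:
  assumes "p \<in> topspace T"
  shows "(norm (W - WN p))\<^sup>2 = (norm W)\<^sup>2 - (norm (WN p))\<^sup>2"
  using WN_inner[OF assms]
  by (simp add: power2_norm_eq_inner inner_diff_left inner_diff_right inner_commute)

text \<open>The derivative of the height along a tangent vector X is X \<bullet> W, which sees only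
  the tangential part of \<open>W\<close>; that part is itself tangent.\<close>

lemma gradient_height:
  assumes "p \<in> topspace T"
  shows "gradient \<A> F (\<lambda>q. F q \<bullet> W) p = W - WN p"
proof -
  note c = chart_at[OF assms]
  let ?c = "chart_at \<A> p"
  have h: "in_chart ?c (\<lambda>q. F q \<bullet> W) = (\<lambda>x. in_chart ?c F x \<bullet> W)"
    by (simp add: in_chart_def split_beta o_def)
  have hd: "(in_chart ?c (\<lambda>q. F q \<bullet> W) has_derivative (\<lambda>a. chart_deriv ?c F p a \<bullet> W)) (at (snd ?c p))"
    unfolding h by (rule has_derivative_inner_left[OF chart_deriv_immersion[OF c]])
  have dd: "dir_deriv \<A> F X (\<lambda>q. F q \<bullet> W) p = (W - WN p) \<bullet> X" if X: "X \<in> tangent_space \<A> F p" for X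
  proof -
    obtain a where a: "X = chart_deriv ?c F p a" using X tangent_space_chart[OF c] by auto
    have "dir_deriv \<A> F X (\<lambda>q. F q \<bullet> W) p = chart_deriv ?c (\<lambda>q. F q \<bullet> W) p a"
      unfolding a by (rule dir_deriv_chart[OF c]) (use hd in \<open>auto simp: differentiable_def\<close>)
    also have "\<dots> = X \<bullet> W" using fun_cong[OF frechet_derivative_at[OF hd], of a] by (simp add: a)
    finally show ?thesis
      using normal_tangent_inner[OF normal_part(1)[OF assms] X, of W]
      by (simp add: inner_diff_left inner_commute[of X W])
  qed
  show ?thesis
    unfolding gradient_def
  proof (rule the_equality)
    show "W - WN p \<in> tangent_space \<A> F p \<and>
        (\<forall>X\<in>tangent_space \<A> F p. (W - WN p) \<bullet> X = dir_deriv \<A> F X (\<lambda>q. F q \<bullet> W) p)"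
      using normal_part(2)[OF assms] dd by simp
    fix w assume w: "w \<in> tangent_space \<A> F p \<and>
        (\<forall>X\<in>tangent_space \<A> F p. w \<bullet> X = dir_deriv \<A> F X (\<lambda>q. F q \<bullet> W) p)"
    let ?d = "w - (W - WN p)"
    have "?d \<in> tangent_space \<A> F p"
      using w normal_part(2)[OF assms] subspace_diff[OF tangent_subspace[OF assms]] by blast
    then have "?d \<bullet> ?d = 0" using w dd[of ?d] by (simp add: inner_diff_left[of w "W - WN p"])
    then show "w = W - WN p" by simp
  qed
qed

lemma principal_normal_smooth:
  assumes c: "c \<in> \<A>" and V: "openin T V" "V \<subseteq> fst c" and nz: "\<And>q. q \<in> V \<Longrightarrow> WN q \<noteq> 0"
    and s: "smooth_on (snd c ` V) (in_chart c WN)"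
  shows "smooth_on (snd c ` V) (in_chart c (principal_normal T \<A> F))"
proof -
  have o: "open (snd c ` V)" by (rule chart_image_open[OF c V])
  have q: "in_chart c f (snd c q) = f q" if "q \<in> V" for q and f :: "'m \<Rightarrow> real ^ ('n + 'k)"
    using in_chart_apply[OF c] V(2) that by auto
  show ?thesis
  proof (rule smooth_on_cong[OF o smooth_on_sgn[OF o s]])
    show "in_chart c WN x \<noteq> 0" if "x \<in> snd c ` V" for x
      using that nz by (auto simp: q)
    show "sgn (in_chart c WN x) = in_chart c (principal_normal T \<A> F) x" if "x \<in> snd c ` V" for x
      using that openin_subset[OF V(1)] by (auto simp: q principal_normal_eq)
  qed
qed

text \<open>The derivative of a unit field is orthogonal to the field, and in codimension one \<xi>
  alone spans the normal space, so this derivative has no normal part.\<close>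

lemma parallel_principal_normal_hypersurface:
  assumes "CARD('k) = 1"
  shows "parallel_principal_normal T \<A> F"
  unfolding parallel_principal_normal_def
proof (intro ballI impI)
  fix p X
  assume p: "p \<in> topspace T" and "mean_curv_vec T \<A> F p \<noteq> 0" and X: "X \<in> tangent_space \<A> F p"
  then have nz: "WN p \<noteq> 0" by (simp add: mean_curv_vec_eq)
  note c = chart_at[OF p]
  let ?c = "chart_at \<A> p" and ?\<xi> = "principal_normal T \<A> F"
  obtain V v where V: "openin T V" "p \<in> V" "V \<subseteq> fst ?c" and s: "smooth_on (snd ?c ` V) (in_chart ?c WN)"
    by (rule soliton_local_structure[OF c]) (rule that)
  \<comment> \<open>The mean curvature may vanish elsewhere in \<open>V\<close>; on
    \<open>V'\<close> the field \<xi> is a smooth unit field.\<close>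
  define V' where "V' = {q \<in> V. WN q \<in> - {0}}"
  have V': "openin T V'" "p \<in> V'" "V' \<subseteq> V" "V' \<subseteq> fst ?c"
    using openin_continuous_map_preimage_gen[OF continuous_WN V(1), of "- {0}"] V nz
    by (auto simp: V'_def)
  let ?S = "snd ?c ` V'"
  have sV': "smooth_on ?S (in_chart ?c WN)"
    by (rule smooth_on_subset[OF s]) (use V'(3) in auto)
  have s\<xi>: "smooth_on ?S (in_chart ?c ?\<xi>)"
    by (rule principal_normal_smooth[OF c(1) V'(1,4) _ sV']) (simp add: V'_def)
  have o: "open ?S" by (rule chart_image_open[OF c(1) V'(1,4)])
  have x: "snd ?c p \<in> ?S" using V'(2) by simp
  note d\<xi> = smooth_on_has_derivative[OF s\<xi> x]
  obtain a where a: "X = chart_deriv ?c F p a" using X tangent_space_chart[OF c] by auto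
  have dd: "dir_deriv \<A> F X ?\<xi> p = chart_deriv ?c ?\<xi> p a"
    unfolding a by (rule dir_deriv_chart[OF c]) (use d\<xi> in \<open>auto simp: differentiable_def\<close>)
  have \<xi>: "?\<xi> q = sgn (WN q)" "in_chart ?c ?\<xi> (snd ?c q) = ?\<xi> q" if "q \<in> V'" for q
    using that V' openin_subset[OF V'(1)] in_chart_apply[OF c(1), of q]
    by (auto simp: principal_normal_eq)
  have unit: "?\<xi> q \<bullet> ?\<xi> q = 1" if "q \<in> V'" for q
    using that by (simp add: \<xi>(1) dot_square_norm norm_sgn V'_def)
  have "in_chart ?c ?\<xi> y \<bullet> in_chart ?c ?\<xi> y = 1" if "y \<in> ?S" for y
    using that unit by (auto simp: \<xi>(2))
  then have "chart_deriv ?c ?\<xi> p a \<bullet> ?\<xi> p = 0"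
    using derivative_of_constant[OF o x has_derivative_inner[OF d\<xi> d\<xi>], of 1 a] V'(2)
    by (simp add: \<xi>(2) inner_commute)
  moreover have "orthonormal_family (\<lambda>\<alpha> :: 'k. ?\<xi> p)"
  proof -
    have "\<alpha> = \<beta>" for \<alpha> \<beta> :: 'k using assms by (metis card_1_singletonE UNIV_I singletonD)
    then show ?thesis using unit[OF V'(2)] by (auto simp: orthonormal_family_def)
  qed
  moreover have "?\<xi> p \<in> normal_space \<A> F p"
    using normal_part(1)[OF p, of W] subspace_scale[OF normal_subspace]
    by (simp add: \<xi>(1)[OF V'(2)] sgn_div_norm)
  ultimately have "normal_part \<A> F p (chart_deriv ?c ?\<xi> p a) = 0"
    using normal_part_normal_frame[OF p, of "\<lambda>\<alpha>. ?\<xi> p"] by simp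
  then show "normal_connection \<A> F X ?\<xi> p = 0"
    by (simp add: normal_connection_def dd)
qed

section \<open>The penalised minimum\<close>

text \<open>In the chart at \<open>p\<close>, |H| is replaced by \<xi> \<bullet> W. Nonvanishing
  makes \<xi> smooth near \<open>p\<close>, and parallelism says that its derivative has zero normal
  part, i.e. lies in the range of DG.\<close>

lemma mean_curvature_bound_at_minimum:
  fixes \<epsilon> :: real
  assumes par: "parallel_principal_normal T \<A> F" and nz: "\<And>q. q \<in> topspace T \<Longrightarrow> WN q \<noteq> 0"
    and p: "p \<in> topspace T" and "norm W = 1" "\<epsilon> \<ge> 0"
    and min: "\<And>q. q \<in> topspace T \<Longrightarrow>
      norm (WN p) + \<epsilon> * (F p \<bullet> F p) \<le> norm (WN q) + \<epsilon> * (F q \<bullet> F q)"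
  shows "norm (WN p) ^ 3 \<le> 2 * CARD('n) * \<epsilon> * (CARD('n) + norm (F p))"
proof -
  note c = chart_at[OF p]
  let ?c = "chart_at \<A> p" and ?\<xi> = "principal_normal T \<A> F"
  obtain V v where V: "openin T V" "p \<in> V" "V \<subseteq> fst ?c"
    and v: "\<And>j :: 'n. smooth_on (snd ?c ` V) (v j)"
    and orth: "\<And>q. q \<in> V \<Longrightarrow> orthonormal_family (\<lambda>j :: 'n. chart_deriv ?c F q (v j (snd ?c q)))"
    and sol: "\<And>q. q \<in> V \<Longrightarrow> \<exists>b. (\<Sum>j\<in>UNIV. fderiv2 (in_chart ?c F) (snd ?c q) (v j (snd ?c q)) (v j (snd ?c q))) =
       chart_deriv ?c F q b - W"
    and s: "smooth_on (snd ?c ` V) (in_chart ?c WN)"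
    by (rule soliton_local_structure[OF c]) (rule that)
  let ?S = "snd ?c ` V" and ?x = "snd ?c p"
  have VT: "q \<in> topspace T" and Vc: "q \<in> fst ?c" if "q \<in> V" for q
    using openin_subset[OF V(1)] V(3) that by auto
  have s\<xi>: "smooth_on ?S (in_chart ?c ?\<xi>)"
    by (rule principal_normal_smooth[OF c(1) V(1,3) _ s]) (simp add: nz VT)
  have o: "open ?S" by (rule chart_image_open[OF c(1) V(1,3)])
  have x: "?x \<in> ?S" using V(2) by simp
  have ap: "in_chart ?c f (snd ?c q) = f q" if "q \<in> V" for q and f :: "'m \<Rightarrow> real ^ ('n + 'k)"
    using in_chart_apply[OF c(1) Vc[OF that]] .
  have \<xi>: "in_chart ?c ?\<xi> (snd ?c q) = sgn (WN q)" if "q \<in> V" for q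
    using that by (simp add: ap principal_normal_eq VT)
  have tangent: "range (chart_deriv ?c F q) = tangent_space \<A> F q" if "q \<in> V" for q
    by (rule tangent_space_chart[OF c(1) Vc[OF that], symmetric])
  have "(in_chart ?c ?\<xi> ?x \<bullet> W) ^ 3 \<le> 2 * CARD('n) * \<epsilon> * (CARD('n) + norm (in_chart ?c F ?x))"
  proof (rule mean_curvature_at_minimum[OF o x])
    show "Ck_on 2 ?S (in_chart ?c F)"
      using smooth_on_subset[OF immersion_smooth[OF c(1)] image_mono[OF V(3)]]
      by (simp add: smooth_on_def)
    show "Ck_on 2 ?S (in_chart ?c ?\<xi>)" using s\<xi> by (simp add: smooth_on_def)
    show "v j differentiable (at ?x)" for j
      using smooth_on_has_derivative[OF v x] by (auto simp: differentiable_def)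
    show "fderiv (in_chart ?c F) y (v i y) \<bullet> fderiv (in_chart ?c F) y (v j y) = (if i = j then 1 else 0)"
      if y: "y \<in> ?S" for y i j
    proof -
      obtain q where q: "q \<in> V" "y = snd ?c q" using y by auto
      show ?thesis using orth[OF q(1)] by (simp add: q(2) orthonormal_family_def)
    qed
    show "range (chart_deriv ?c F p) \<subseteq> span (range (\<lambda>j. chart_deriv ?c F p (v j ?x)))"
    proof (rule orthonormal_family_spans[OF orth[OF V(2)]])
      show "dim (range (chart_deriv ?c F p)) = CARD('n)"
        by (simp only: tangent[OF V(2)] dim_tangent[OF p])
    qed blast
    show "in_chart ?c ?\<xi> y \<bullet> fderiv (in_chart ?c F) y w = 0" if y: "y \<in> ?S" for y w
    proof -
      obtain q where q: "q \<in> V" "y = snd ?c q" using y by auto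
      have "WN q \<bullet> chart_deriv ?c F q w = 0"
        using tangent[OF q(1)] by (intro normal_tangent_inner[OF normal_part(1)[OF VT[OF q(1)]]]) auto
      then show ?thesis by (simp add: q(2) \<xi>[OF q(1)] sgn_div_norm)
    qed
    show "in_chart ?c ?\<xi> y \<bullet> in_chart ?c ?\<xi> y = 1" if "y \<in> ?S" for y
      using that nz VT by (auto simp: \<xi> dot_square_norm norm_sgn)
    show "chart_deriv ?c ?\<xi> p w \<in> range (chart_deriv ?c F p)" for w
    proof -
      let ?X = "chart_deriv ?c F p w"
      have X: "?X \<in> tangent_space \<A> F p" using tangent[OF V(2)] by auto
      have dd: "dir_deriv \<A> F ?X ?\<xi> p = chart_deriv ?c ?\<xi> p w"
        by (rule dir_deriv_chart[OF c])
          (use smooth_on_has_derivative[OF s\<xi> x] in \<open>auto simp: differentiable_def\<close>)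
      have "mean_curv_vec T \<A> F p \<noteq> 0" using nz[OF p] by (simp add: mean_curv_vec_eq p)
      then have "normal_connection \<A> F ?X ?\<xi> p = 0"
        using par p X unfolding parallel_principal_normal_def by blast
      then have "normal_part \<A> F p (chart_deriv ?c ?\<xi> p w) = 0"
        by (simp add: normal_connection_def dd)
      then show ?thesis
        using normal_part(2)[OF p, of "chart_deriv ?c ?\<xi> p w"] tangent[OF V(2)] by simp
    qed
    have "norm (WN p) *\<^sub>R sgn (WN p) = WN p" by (simp add: sgn_div_norm nz[OF p])
    then show "W - (in_chart ?c ?\<xi> ?x \<bullet> W) *\<^sub>R in_chart ?c ?\<xi> ?x \<in> range (chart_deriv ?c F p)"
      using normal_part(2)[OF p, of W] by (simp add: \<xi>[OF V(2)] sgn_WN_inner[OF p] tangent[OF V(2)])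
    show "\<exists>b. (\<Sum>j\<in>UNIV. fderiv2 (in_chart ?c F) y (v j y) (v j y)) = fderiv (in_chart ?c F) y b - W"
      if "y \<in> ?S" for y
      using that sol by blast
    show "in_chart ?c ?\<xi> ?x \<bullet> W + \<epsilon> * (in_chart ?c F ?x \<bullet> in_chart ?c F ?x) \<le>
        in_chart ?c ?\<xi> y \<bullet> W + \<epsilon> * (in_chart ?c F y \<bullet> in_chart ?c F y)" if "y \<in> ?S" for y
      using that min VT by (auto simp: ap V(2) principal_normal_eq sgn_WN_inner p)
    show "0 \<le> in_chart ?c ?\<xi> ?x \<bullet> W" by (simp add: \<xi>[OF V(2)] sgn_WN_inner[OF p])
  qed (use assms in auto)
  then show ?thesis by (simp add: ap[OF V(2)] principal_normal_eq[OF p] sgn_WN_inner[OF p])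
qed

text \<open>The penalty alone exceeds the value at \<open>p0\<close> outside a large ball, and by
  properness the preimage of the ball is compact.\<close>

lemma proper_minimum_exists:
  fixes \<epsilon> :: real
  assumes proper: "proper_map T euclidean F" and "topspace T \<noteq> {}" and "\<epsilon> > 0"
  obtains p where "p \<in> topspace T"
    "\<And>q. q \<in> topspace T \<Longrightarrow> norm (WN p) + \<epsilon> * (F p \<bullet> F p) \<le> norm (WN q) + \<epsilon> * (F q \<bullet> F q)"
proof -
  define f where "f q = norm (WN q) + \<epsilon> * (F q \<bullet> F q)" for q
  obtain p0 where p0: "p0 \<in> topspace T" using assms(2) by blast
  \<comment> \<open>Chosen so that \<epsilon> * R^2 is exactly the value of \<open>f\<close> at
    \<open>p0\<close>.\<close>
  define R where "R = sqrt (f p0 / \<epsilon>)"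
  have R: "\<epsilon> * R\<^sup>2 = f p0" "R \<ge> 0"
    using \<open>\<epsilon> > 0\<close> by (auto simp: R_def f_def)
  define K where "K = {q \<in> topspace T. F q \<in> cball 0 R}"
  have outside: "f p0 < f q" if "q \<in> topspace T" "q \<notin> K" for q
  proof -
    have "R\<^sup>2 < (norm (F q))\<^sup>2"
      using that R(2) by (intro power_strict_mono) (auto simp: K_def)
    then have "\<epsilon> * R\<^sup>2 < \<epsilon> * (F q \<bullet> F q)" using \<open>\<epsilon> > 0\<close> by (simp add: power2_norm_eq_inner)
    then show ?thesis using R by (simp add: f_def add_strict_increasing2)
  qed
  have "p0 \<in> K" using outside p0 by blast
  have "compactin T K"
    using proper unfolding proper_map_alt K_def by (metis compactin_euclidean_iff compact_cball)
  have "continuous_map T euclidean f"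
    using continuous_WN continuous_immersion unfolding f_def continuous_map_atin limitin_canonical_iff
    by (intro ballI tendsto_intros) auto
  then have "compact (f ` K)"
    using image_compactin[OF \<open>compactin T K\<close>] by (metis compactin_euclidean_iff)
  then obtain p where p: "p \<in> K" "\<And>q. q \<in> K \<Longrightarrow> f p \<le> f q"
    using compact_attains_inf[of "f ` K"] \<open>p0 \<in> K\<close> by blast
  have "f p \<le> f q" if "q \<in> topspace T" for q
  proof (cases "q \<in> K")
    case False
    then show ?thesis using outside[OF that] p(2)[OF \<open>p0 \<in> K\<close>] by linarith
  qed (use p in auto)
  then show ?thesis using p(1) by (intro that[of p]) (auto simp: K_def f_def)
qed

lemma mean_curvature_not_bounded_below:
  assumes par: "parallel_principal_normal T \<A> F" and "norm W = 1"
    and proper: "proper_map T euclidean F" and ne: "topspace T \<noteq> {}"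
    and "\<delta> > 0"
  shows "\<exists>q\<in>topspace T. norm (WN q) < \<delta>"
proof (rule ccontr)
  assume "\<not> ?thesis"
  then have low: "\<delta> \<le> norm (WN q)" if "q \<in> topspace T" for q using that by force
  then have nz: "WN q \<noteq> 0" if "q \<in> topspace T" for q using that \<open>\<delta> > 0\<close> by fastforce
  have le1: "norm (WN q) \<le> 1" if "q \<in> topspace T" for q
    using norm_tangential_part[OF that] \<open>norm W = 1\<close>
    by (metis diff_ge_0_iff_ge norm_ge_zero one_power2 power2_le_imp_le zero_le_one zero_le_power2)
  obtain p0 where p0: "p0 \<in> topspace T" using ne by blast
  let ?n = "real CARD('n)"
  \<comment> \<open>\<open>D\<close> bounds \<open>s * norm (F p)\<close> for every
    \<open>s \<le> 1\<close>: comparison with \<open>p0\<close> gives s^2 |F(p)|^2 \<le> 1 + s^2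
    |F(p0)|^2, where the 1 bounds |H(p0)|.\<close>
  define D where "D = sqrt (1 + F p0 \<bullet> F p0)"
  have D: "D > 0" "D\<^sup>2 = 1 + F p0 \<bullet> F p0" by (auto simp: D_def add_pos_nonneg)
  have n: "?n > 0" by simp
  \<comment> \<open>The penalty parameter is \<epsilon> = s^2. The second entry makes 2 n s (n + D)
    at most half of \<delta>^3.\<close>
  define s where "s = min 1 (\<delta> ^ 3 / (4 * ?n * (?n + D)))"
  have s: "0 < s" "s \<le> 1" using \<open>\<delta> > 0\<close> D n by (auto simp: s_def)
  obtain p where p: "p \<in> topspace T"
    and min: "\<And>q. q \<in> topspace T \<Longrightarrow>
      norm (WN p) + s\<^sup>2 * (F p \<bullet> F p) \<le> norm (WN q) + s\<^sup>2 * (F q \<bullet> F q)"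
    using proper_minimum_exists[OF proper ne, of "s\<^sup>2"] s by (metis zero_less_power)
  have "(s * norm (F p))\<^sup>2 = s\<^sup>2 * (F p \<bullet> F p)" by (simp add: power_mult_distrib power2_norm_eq_inner)
  also have "\<dots> \<le> 1 + s\<^sup>2 * (F p0 \<bullet> F p0)"
    using min[OF p0] le1[OF p0] norm_ge_zero[of "WN p"] by linarith
  also have "\<dots> \<le> D\<^sup>2"
    unfolding D(2) using s(2) less_imp_le[OF s(1)]
    by (intro add_left_mono mult_left_le_one_le power_le_one inner_ge_zero zero_le_power2)
  finally have sF: "s * norm (F p) \<le> D" by (rule power2_le_imp_le[OF _ less_imp_le[OF D(1)]])
  have "\<delta> ^ 3 \<le> norm (WN p) ^ 3" using low[OF p] \<open>\<delta> > 0\<close> by (intro power_mono) auto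
  also have "\<dots> \<le> 2 * ?n * s\<^sup>2 * (?n + norm (F p))"
    using mean_curvature_bound_at_minimum[OF par nz p \<open>norm W = 1\<close> _ min] by simp
  \<comment> \<open>One factor \<open>s\<close> is spent on keeping \<open>s * norm (F p)\<close>
    below \<open>D\<close>; the other remains and makes the bound small.\<close>
  also have "\<dots> = 2 * ?n * s * (s * ?n + s * norm (F p))"
    by (simp add: power2_eq_square algebra_simps)
  also have "\<dots> \<le> 2 * ?n * s * (?n + D)"
    using s sF n by (intro mult_left_mono add_mono) (auto simp: mult_left_le_one_le)
  also have "\<dots> \<le> 2 * ?n * (\<delta> ^ 3 / (4 * ?n * (?n + D))) * (?n + D)"
    using D n by (intro mult_right_mono mult_left_mono) (auto simp: s_def)
  also have "\<dots> = \<delta> ^ 3 / 2"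
  proof -
    have cancel: "2 * a * (y / (4 * a * b)) * b = y / 2" if "a > 0" "b > 0" for a b y :: real
      using that by (simp add: field_simps)
    show ?thesis using n D(1) by (intro cancel) auto
  qed
  finally show False using zero_less_power[OF \<open>\<delta> > 0\<close>, of 3] by linarith
qed

end

text \<open>For reals, suprema and infima need nonempty bounded sets; nonnegativity of
  \<open>f\<close> bounds \<open>f\<close> below and \<open>g\<close> above by 1.\<close>

lemma SUP_one_minus:
  fixes f g :: "'a \<Rightarrow> real"
  assumes "A \<noteq> {}" "\<And>x. x \<in> A \<Longrightarrow> 0 \<le> f x" "\<And>x. x \<in> A \<Longrightarrow> g x = 1 - f x"
  shows "(SUP x\<in>A. g x) = 1 - (INF x\<in>A. f x)"
proof (rule antisym)
  have below: "bdd_below (f ` A)" using assms(2) by (rule bdd_belowI2)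
  have above: "bdd_above (g ` A)" using assms(2,3) by (intro bdd_aboveI2[of _ _ 1]) simp
  show "(SUP x\<in>A. g x) \<le> 1 - (INF x\<in>A. f x)"
    using cINF_lower[OF below] assms(3) by (intro cSUP_least assms(1)) simp
  have "1 - (SUP x\<in>A. g x) \<le> (INF x\<in>A. f x)"
  proof (rule cINF_greatest[OF assms(1)])
    show "1 - (SUP x\<in>A. g x) \<le> f x" if "x \<in> A" for x
      using cSUP_upper[OF that above] assms(3)[OF that] by linarith
  qed
  then show "1 - (INF x\<in>A. f x) \<le> (SUP x\<in>A. g x)" by simp
qed

theorem proposition1:
  fixes T :: "'m topology"
    and \<A> :: "('m, 'n::finite) chart set"
    and F :: "'m \<Rightarrow> real ^ ('n + 'k::finite)"
    and W :: "real ^ ('n + 'k)"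
  assumes "norm W = 1"
    and "smooth_manifold T \<A>" and "topspace T \<noteq> {}"
    and "immersion T \<A> F"
    and "complete_immersed T \<A> F"
    and "proper_map T euclidean F"
    and "translating_soliton T \<A> F W"
  defines "S \<equiv> \<lambda>p. F p \<bullet> W"
  shows "(CARD('k) = 1 \<longrightarrow> parallel_principal_normal T \<A> F) \<and>
         (parallel_principal_normal T \<A> F \<longrightarrow>
            (INF p\<in>topspace T. (norm (mean_curv_vec T \<A> F p))\<^sup>2) = 0 \<and>
            (SUP p\<in>topspace T. (norm (gradient \<A> F S p))\<^sup>2) = 1) \<and>
         ((INF p\<in>topspace T. (norm (mean_curv_vec T \<A> F p))\<^sup>2) = 0 \<longleftrightarrow>
          (SUP p\<in>topspace T. (norm (gradient \<A> F S p))\<^sup>2) = 1)"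
proof -
  interpret soliton T \<A> F W
    using assms by unfold_locales
  let ?H = "\<lambda>p. (norm (mean_curv_vec T \<A> F p))\<^sup>2"
  have H: "norm (mean_curv_vec T \<A> F p) = norm (WN p)" if "p \<in> topspace T" for p
    using that by (simp add: mean_curv_vec_eq)
  have "(norm (gradient \<A> F S p))\<^sup>2 = 1 - ?H p" if "p \<in> topspace T" for p
    using norm_tangential_part[OF that] that \<open>norm W = 1\<close>
    by (simp add: S_def gradient_height H)
  then have sup: "(SUP p\<in>topspace T. (norm (gradient \<A> F S p))\<^sup>2) = 1 - (INF p\<in>topspace T. ?H p)"
    by (intro SUP_one_minus assms(3)) auto
  have below: "bdd_below (?H ` topspace T)" by (rule bdd_belowI2[of _ 0]) simp
  have inf: "(INF p\<in>topspace T. ?H p) = 0" if par: "parallel_principal_normal T \<A> F"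
  proof (rule antisym)
    show "0 \<le> (INF p\<in>topspace T. ?H p)" by (intro cINF_greatest assms(3)) simp
    show "(INF p\<in>topspace T. ?H p) \<le> 0"
    proof (rule field_le_epsilon)
      fix e :: real assume "e > 0"
      \<comment> \<open>The infimum is that of |H|^2, hence \<open>sqrt e\<close> as the bound for
        |H|.\<close>
      then obtain q where q: "q \<in> topspace T" "norm (WN q) < sqrt e"
        using mean_curvature_not_bounded_below[OF par assms(1,6,3), of "sqrt e"] by auto
      then have "?H q < (sqrt e)\<^sup>2" unfolding H[OF q(1)] by (intro power_strict_mono) auto
      then have "?H q \<le> e" using \<open>e > 0\<close> by simp
      then show "(INF p\<in>topspace T. ?H p) \<le> 0 + e"
        using cINF_lower[OF below q(1)] by linarith
    qed
  qed
  show ?thesis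
    using parallel_principal_normal_hypersurface inf sup by auto
qed

end
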